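(* Assume that the problem $$dx(t)=f(t,x(t),x(t-\tau(t)))\,dt+g(t,x(t),x(t-\tau(t)))\,dw(t),\ t\in[a,+\infty),\qquad x(t)=\xi(t),\ t\in[a-\tau_0,a],$$ belongs to $\overline{\mathcal{SD}}(\alpha,\beta,\gamma_1,\gamma_2)$ with constant $\alpha,\beta,\gamma_1,\gamma_2$, and that $$\lim_{t\to+\infty}(t-\tau(t))=+\infty,\qquad c=2\alpha+2\beta+\gamma_1^2+2\gamma_1\gamma_2+\gamma_2^2<0.$$ Let $\{X_n\}$ and $\{Y_n\}$ be the two sequences of numerical solutions obtained by the backward Euler method with stepsize $h$ (same $f,g,\tau,w$) from initial functions $\xi$ and $\eta$ respectively, $\xi,\eta\in L^p_{\mathcal F_a}([a-\tau_0,a];\mathbb C^d)$. Then: (i) there exists a strictly increasing integer sequence $\{n_k\}$ which diverges to $+\infty$ as $k\to+\infty$, where $n_0=0$, such that for any given $h>0$, $$\max_{n_k<i\le n_{k+1}}\mathbb E|X_i-Y_i|^2\le c_2^{k+1}\sup_{a-\tau_0\le t\le a}\mathbb E|\xi(t)-\eta(t)|^2,\qquad k=0,1,2,\dots,$$ where $$c_2=\max\left\{\frac{1+h\gamma_1^2+2h\gamma_1\gamma_2+h\gamma_2^2}{1-2h\alpha-2h\beta},\ \frac{1+h\beta+h\gamma_1^2+2h\gamma_1\gamma_2+h\gamma_2^2}{1-2h\alpha-h\beta}\right\}=\frac{1+h\beta+h\gamma_1^2+2h\gamma_1\gamma_2+h\gamma_2^2}{1-2h\alpha-h\beta}<1;$$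 (ii) for any given $h>0$, $\displaystyle\lim_{n\to+\infty}\mathbb E|X_n-Y_n|^2=0.$
   Context: Setting. $(\Omega,\mathcal F,\{\mathcal F_t\}_{t\ge a},\mathbb P)$ is a complete probability space with a filtration satisfying the usual conditions (right continuous, $\mathcal F_a$ contains all $\mathbb P$-null sets), and $w$ is an $m$-dimensional Wiener process on it. $\langle\cdot,\cdot\rangle$ is the inner product on $\mathbb C^d$ and $|\cdot|$ the corresponding norm; on $\mathbb C^{d\times m}$, $|\cdot|$ is the trace (Frobenius) norm. $\Re$ denotes real part and $\mathbb E$ expectation with respect to $\mathbb P$. A number $p>2$ is fixed, and $L^p_{\mathcal F_t}([t_1,t_2];\mathbb C^d)$ is the family of $\mathcal F_t$-measurable $C([t_1,t_2];\mathbb C^d)$-valued random variables $\psi$ with $\sup_{t_1\le u\le t_2}\mathbb E|\psi(u)|^p<\infty$. The constants satisfy $-\infty<a$, $\tau_0\ge0$; the delay satisfies $\tau(t)\ge0$ and $\inf_{t\ge a}(t-\tau(t))\ge a-\tau_0$; $f:[a,+\infty)\times\mathbb C^d\times\mathbb C^d\to\mathbb C^d$ and $g:[a,+\infty)\times\mathbb C^d\times\mathbb C^d\to\mathbb C^{d\times m}$ are continuous. Equations are in the Itô sense. The problem belongs to $\overline{\mathcal{SD}}(\alpha,\beta,\gamma_1,\gamma_2)$ (here with real constants $\alpha,\beta,\gamma_1,\gamma_2$) if for all $t\in[a,+\infty)$ and $x,x_1,x_2,y,y_1,y_2\in\mathbb C^d$: (1) for each $R>0$ there is a constant $C_R$ depending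 only on $R$ with $|f(t,x_1,y)-f(t,x_2,y)|\le C_R|x_1-x_2|$ whenever $|x_1|,|x_2|,|y|\le R$; (2) $\Re\langle x_1-x_2,f(t,x_1,y)-f(t,x_2,y)\rangle\le\alpha|x_1-x_2|^2$; (3) $|f(t,x,y_1)-f(t,x,y_2)|\le\beta|y_1-y_2|$; (4) $|g(t,x_1,y_1)-g(t,x_2,y_2)|\le\gamma_1|x_1-x_2|+\gamma_2|y_1-y_2|$. Backward Euler method with stepsize $h>0$: with $t_n=a+nh$, $\Delta w_n=w(t_{n+1})-w(t_n)$, $X_0=\xi(a)$, $$X_{n+1}=X_n+hf\big(t_{n+1},X_{n+1},X^h(t_{n+1}-\tau(t_{n+1}))\big)+g\big(t_n,X_n,X^h(t_n-\tau(t_n))\big)\Delta w_n,\quad n=0,1,2,\dots,$$ where $X^h(t)=\xi(t)$ for $a-\tau_0\le t\le a$ and $X^h(t)=\frac1h[(t_{i+1}-t)X_i+(t-t_i)X_{i+1}]$ for $t_i\le t\le t_{i+1}$, $i=0,1,2,\dots$. $\{Y_n\}$ is defined in the same way with $\eta$ in place of $\xi$.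
   Formalization: In (i) the sequence {n_k} may depend on the stepsize h (for every h>0 there is {n_k}); a single {n_k} valid for all h fails, e.g. for f=-2x+y, g=0, a=τ_0=0, t-τ(t)=log(1+t), ξ=1, η=0 as h→∞. *)

theory Defs
  imports "HOL-Probability.Probability"
begin

(* Only the index set [a, infinity) matters; F t is irrelevant for t < a. *)
definition usual_filtration :: "'a measure \<Rightarrow> real \<Rightarrow> (real \<Rightarrow> 'a measure) \<Rightarrow> bool" where
  "usual_filtration M a F \<longleftrightarrow>
     (\<forall>t\<ge>a. subalgebra M (F t)) \<and>
     (\<forall>s t. a \<le> s \<and> s \<le> t \<longrightarrow> sets (F s) \<subseteq> sets (F t)) \<and>
     (\<forall>t\<ge>a. sets (F t) = (\<Inter>s\<in>{t<..}. sets (F s))) \<and>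
     null_sets M \<subseteq> sets (F a)"

(* The starting value w a is not normalised, since only increments of w are ever used;
   in particular the usual case w a = 0 is covered. *)
definition wiener_process ::
  "'a measure \<Rightarrow> real \<Rightarrow> (real \<Rightarrow> 'a measure) \<Rightarrow> (real \<Rightarrow> 'a \<Rightarrow> real ^ 'm) \<Rightarrow> bool" where
  "wiener_process M a F w \<longleftrightarrow>
     (\<forall>t\<ge>a. w t \<in> borel_measurable (F t)) \<and>
     (AE \<omega> in M. continuous_on {a..} (\<lambda>t. w t \<omega>)) \<and>
     (\<forall>s t. a \<le> s \<and> s < t \<longrightarrow>
        prob_space.indep_set M (sets (F s))
          (sets (vimage_algebra (space M) (\<lambda>\<omega>. w t \<omega> - w s \<omega>) borel)) \<and>
        prob_space.indep_vars M (\<lambda>_. borel) (\<lambda>j \<omega>. (w t \<omega> - w s \<omega>) $ j) UNIV \<and>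
        (\<forall>j. distributed M lborel (\<lambda>\<omega>. (w t \<omega> - w s \<omega>) $ j)
               (normal_density 0 (sqrt (t - s)))))"

(* G-measurable random variables with values in C([t1,t2]; C^d) and bounded p-th moments.
   A path-valued map is measurable for the Borel sets of the uniform norm iff all its
   evaluations are measurable, which is how measurability is expressed here.
   The moments are extended-valued, so finiteness of the supremum is a genuine condition. *)
definition Lp_paths ::
  "real \<Rightarrow> 'a measure \<Rightarrow> 'a measure \<Rightarrow> real \<Rightarrow> real \<Rightarrow> (real \<Rightarrow> 'a \<Rightarrow> complex ^ 'd) set" where
  "Lp_paths p M G t1 t2 =
     {\<psi>. (\<forall>\<omega>\<in>space M. continuous_on {t1..t2} (\<lambda>u. \<psi> u \<omega>)) \<and>
          (\<forall>u\<in>{t1..t2}. \<psi> u \<in> borel_measurable G) \<and>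
          (SUP u\<in>{t1..t2}. \<integral>\<^sup>+ \<omega>. ennreal (norm (\<psi> u \<omega>) powr p) \<partial>M) < \<infinity>}"

(* The library's inner product on complex ^ 'd is only the real one. *)
definition cinner :: "complex ^ 'd \<Rightarrow> complex ^ 'd \<Rightarrow> complex" where
  "cinner x y = (\<Sum>i\<in>UNIV. x $ i * cnj (y $ i))"

(* The library norm on complex ^ 'm ^ 'd is the Frobenius (trace) norm of d x m matrices. *)
definition SD_class ::
  "real \<Rightarrow> (real \<Rightarrow> complex ^ 'd \<Rightarrow> complex ^ 'd \<Rightarrow> complex ^ 'd) \<Rightarrow>
   (real \<Rightarrow> complex ^ 'd \<Rightarrow> complex ^ 'd \<Rightarrow> complex ^ 'm ^ 'd) \<Rightarrow>
   real \<Rightarrow> real \<Rightarrow> real \<Rightarrow> real \<Rightarrow> bool" where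
  "SD_class a f g \<alpha> \<beta> \<gamma>1 \<gamma>2 \<longleftrightarrow>
     (\<forall>R>0. \<exists>C. \<forall>t\<ge>a. \<forall>x1 x2 y. norm x1 \<le> R \<and> norm x2 \<le> R \<and> norm y \<le> R \<longrightarrow>
        norm (f t x1 y - f t x2 y) \<le> C * norm (x1 - x2)) \<and>
     (\<forall>t\<ge>a. \<forall>x1 x2 y.
        Re (cinner (x1 - x2) (f t x1 y - f t x2 y)) \<le> \<alpha> * (norm (x1 - x2))\<^sup>2) \<and>
     (\<forall>t\<ge>a. \<forall>x y1 y2. norm (f t x y1 - f t x y2) \<le> \<beta> * norm (y1 - y2)) \<and>
     (\<forall>t\<ge>a. \<forall>x1 x2 y1 y2.
        norm (g t x1 y1 - g t x2 y2) \<le> \<gamma>1 * norm (x1 - x2) + \<gamma>2 * norm (y1 - y2))"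

definition grid :: "real \<Rightarrow> real \<Rightarrow> nat \<Rightarrow> real" where
  "grid a h n = a + real n * h"

(* The continuous extension X^h: for t > a the index i is the one with
   grid a h i <= t < grid a h (Suc i). *)
definition interpolant ::
  "real \<Rightarrow> real \<Rightarrow> (real \<Rightarrow> 'a \<Rightarrow> complex ^ 'd) \<Rightarrow> (nat \<Rightarrow> 'a \<Rightarrow> complex ^ 'd) \<Rightarrow>
   real \<Rightarrow> 'a \<Rightarrow> complex ^ 'd" where
  "interpolant a h \<xi> X t \<omega> =
     (if t \<le> a then \<xi> t \<omega>
      else let i = nat \<lfloor>(t - a) / h\<rfloor> in
        (1 / h) *\<^sub>R ((grid a h (Suc i) - t) *\<^sub>R X i \<omega> + (t - grid a h i) *\<^sub>R X (Suc i) \<omega>))"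

definition backward_euler ::
  "'a measure \<Rightarrow> real \<Rightarrow> (real \<Rightarrow> real) \<Rightarrow>
   (real \<Rightarrow> complex ^ 'd \<Rightarrow> complex ^ 'd \<Rightarrow> complex ^ 'd) \<Rightarrow>
   (real \<Rightarrow> complex ^ 'd \<Rightarrow> complex ^ 'd \<Rightarrow> complex ^ 'm ^ 'd) \<Rightarrow>
   (real \<Rightarrow> 'a \<Rightarrow> real ^ 'm) \<Rightarrow> real \<Rightarrow>
   (real \<Rightarrow> 'a \<Rightarrow> complex ^ 'd) \<Rightarrow> (nat \<Rightarrow> 'a \<Rightarrow> complex ^ 'd) \<Rightarrow> bool" where
  "backward_euler M a \<tau> f g w h \<xi> X \<longleftrightarrow>
     (AE \<omega> in M. X 0 \<omega> = \<xi> a \<omega>) \<and>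
     (\<forall>n. AE \<omega> in M.
        X (Suc n) \<omega> = X n \<omega>
          + h *\<^sub>R f (grid a h (Suc n)) (X (Suc n) \<omega>)
               (interpolant a h \<xi> X (grid a h (Suc n) - \<tau> (grid a h (Suc n))) \<omega>)
          + g (grid a h n) (X n \<omega>) (interpolant a h \<xi> X (grid a h n - \<tau> (grid a h n)) \<omega>)
              *v (\<chi> j. complex_of_real ((w (grid a h (Suc n)) \<omega> - w (grid a h n) \<omega>) $ j)))"

(* E|Z|^2 as an extended nonnegative number; unlike the Bochner integral it does not
   collapse to 0 when Z is not square integrable. *)
definition mean_square :: "'a measure \<Rightarrow> ('a \<Rightarrow> complex ^ 'd) \<Rightarrow> ennreal" where
  "mean_square M Z = (\<integral>\<^sup>+ \<omega>. ennreal ((norm (Z \<omega>))\<^sup>2) \<partial>M)"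

end

theory Submission
  imports Defs
begin

text \<open>
  One step of the scheme contracts in mean square. Testing the difference of the two implicit
  equations with \<open>Z\<^sub>n\<^sub>+\<^sub>1 = X\<^sub>n\<^sub>+\<^sub>1 - Y\<^sub>n\<^sub>+\<^sub>1\<close> itself and using the one-sided Lipschitz condition gives
  \<open>(1 - 2h\<alpha> - h\<beta>) |Z\<^sub>n\<^sub>+\<^sub>1|\<^sup>2 \<le> h\<beta> |U\<^sub>n\<^sub>+\<^sub>1|\<^sup>2 + |Z\<^sub>n + \<Delta>g \<Delta>w|\<^sup>2\<close>, where \<open>U\<close> is the difference of the
  delayed values; the last term has expectation \<open>E |Z\<^sub>n|\<^sup>2 + h E |\<Delta>g|\<^sup>2\<close> by independence of the
  increment. The delay may be shorter than \<open>h\<close>, so \<open>U\<^sub>n\<^sub>+\<^sub>1 = (1 - l) V + l Z\<^sub>n\<^sub>+\<^sub>1\<close> with \<open>V\<close> from the past;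
  absorbing the \<open>l\<close>-part on the left shows that a bound \<open>K\<close> on the relevant past second moments
  yields the bound \<open>c\<^sub>2 K\<close> for the new one. Since \<open>t - \<tau>(t) \<rightarrow> \<infinity>\<close>, beyond a suitable index only
  values after \<open>n\<^sub>k\<close> are consulted, and the factor \<open>c\<^sub>2\<close> is gained once more.

  Independence needs adaptedness of \<open>X\<^sub>n\<close>, which is not part of the definition of the scheme: by
  monotonicity the solution of the implicit equation is a Lipschitz function of its data on the
  set of data for which it is solvable.
\<close>

section \<open>Stability of one implicit step\<close>

lemma Re_cinner_eq_inner: "Re (cinner x y) = inner x y"
  by (simp add: cinner_def inner_vec_def inner_complex_def)

text \<open>Inserting \<open>f y u\<close> splits the drift difference into a part with common
  delayed argument, controlled by the one-sided condition, and a part with common state, controlled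
  by \<beta>. The product with \<open>p - q\<close> stays unestimated, because it is later treated
  once by Young and once by Cauchy-Schwarz.\<close>

lemma implicit_step_difference_bound:
  fixes x y u v p q :: "'b::real_inner"
  assumes mono: "\<And>x y u. inner (x - y) (f x u - f y u) \<le> \<alpha> * (norm (x - y))\<^sup>2"
    and lip: "\<And>x u v. norm (f x u - f x v) \<le> \<beta> * norm (u - v)"
    and h: "0 \<le> h"
    and x: "x = p + h *\<^sub>R f x u" and y: "y = q + h *\<^sub>R f y v"
  shows "(norm (x - y))\<^sup>2 \<le> h * \<alpha> * (norm (x - y))\<^sup>2 + h * \<beta> * norm (x - y) * norm (u - v)
    + inner (x - y) (p - q)"
proof -
  have "x - y = (p - q) + h *\<^sub>R ((f x u - f y u) + (f y u - f y v))"
    by (subst x, subst y) (simp add: algebra_simps)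
  then have "inner (x - y) (x - y)
      = inner (x - y) ((p - q) + h *\<^sub>R ((f x u - f y u) + (f y u - f y v)))"
    by simp
  then have "(norm (x - y))\<^sup>2
      = inner (x - y) (p - q) + h * (inner (x - y) (f x u - f y u) + inner (x - y) (f y u - f y v))"
    by (simp only: power2_norm_eq_inner inner_add_right inner_scaleR_right)
  moreover have "inner (x - y) (f y u - f y v) \<le> norm (x - y) * (\<beta> * norm (u - v))"
    by (meson Cauchy_Schwarz_ineq2 abs_le_D1 lip mult_left_mono norm_ge_zero order_trans)
  then have "h * (inner (x - y) (f x u - f y u) + inner (x - y) (f y u - f y v))
      \<le> h * (\<alpha> * (norm (x - y))\<^sup>2 + norm (x - y) * (\<beta> * norm (u - v)))"
    using mono[of x y u] h by (intro mult_left_mono add_mono)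
  ultimately show ?thesis by (simp add: algebra_simps)
qed

text \<open>Double the difference bound and apply Young's inequality to both mixed products: the
  delay term moves \<open>h * \<beta>\<close> to the left and the data term moves 1 there. The
  resulting left factor is the denominator of the second quotient in \<open>c2\<close>.\<close>

lemma implicit_step_energy:
  fixes x y u v p q :: "'b::real_inner"
  assumes mono: "\<And>x y u. inner (x - y) (f x u - f y u) \<le> \<alpha> * (norm (x - y))\<^sup>2"
    and lip: "\<And>x u v. norm (f x u - f x v) \<le> \<beta> * norm (u - v)"
    and h: "0 \<le> h" and \<beta>: "0 \<le> \<beta>"
    and x: "x = p + h *\<^sub>R f x u" and y: "y = q + h *\<^sub>R f y v"
  shows "(1 - 2 * h * \<alpha> - h * \<beta>) * (norm (x - y))\<^sup>2 \<le> h * \<beta> * (norm (u - v))\<^sup>2 + (norm (p - q))\<^sup>2"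
proof -
  have 1: "2 * inner (x - y) (p - q) \<le> (norm (x - y))\<^sup>2 + (norm (p - q))\<^sup>2"
    using zero_le_power2[of "norm ((x - y) - (p - q))"]
    by (simp add: power2_norm_eq_inner inner_diff_left inner_diff_right inner_commute)
  have "2 * (norm (x - y) * norm (u - v)) \<le> (norm (x - y))\<^sup>2 + (norm (u - v))\<^sup>2"
    using sum_squares_bound[of "norm (x - y)" "norm (u - v)"] by simp
  then have "h * \<beta> * (2 * (norm (x - y) * norm (u - v)))
      \<le> h * \<beta> * ((norm (x - y))\<^sup>2 + (norm (u - v))\<^sup>2)"
    using h \<beta> by (intro mult_left_mono) auto
  then show ?thesis
    using implicit_step_difference_bound[where f = f, OF mono lip h x y] 1
    by (simp add: algebra_simps)
qed

text \<open>Serves the measurability argument. The delayed argument may contain a share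
  \<open>l\<close> of the unknown itself; this adds at most \<open>h * l * \<beta>\<close> times the
  squared error, which \<open>\<alpha> + \<beta> \<le> 0\<close> absorbs. Two given solutions are
  compared; existence is not claimed.\<close>

lemma implicit_step_lipschitz:
  fixes x y c d p q :: "'b::real_inner"
  assumes mono: "\<And>x y u. inner (x - y) (f x u - f y u) \<le> \<alpha> * (norm (x - y))\<^sup>2"
    and lip: "\<And>x u v. norm (f x u - f x v) \<le> \<beta> * norm (u - v)"
    and h: "0 \<le> h" and \<beta>: "0 \<le> \<beta>" and \<alpha>: "\<alpha> + \<beta> \<le> 0" and l: "0 \<le> l" "l \<le> 1"
    and x: "x = p + h *\<^sub>R f x (c + l *\<^sub>R x)" and y: "y = q + h *\<^sub>R f y (d + l *\<^sub>R y)"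
  shows "norm (x - y) \<le> norm (p - q) + h * \<beta> * norm (c - d)"
proof (cases "x = y")
  case False
  let ?e = "norm (x - y)"
  have "norm ((c + l *\<^sub>R x) - (d + l *\<^sub>R y)) = norm ((c - d) + l *\<^sub>R (x - y))"
    by (simp add: algebra_simps)
  also have "\<dots> \<le> norm (c - d) + l * ?e"
    using norm_triangle_ineq[of "c - d" "l *\<^sub>R (x - y)"] l by simp
  finally have "h * \<beta> * ?e * norm ((c + l *\<^sub>R x) - (d + l *\<^sub>R y))
      \<le> h * \<beta> * ?e * (norm (c - d) + l * ?e)"
    using h \<beta> by (intro mult_left_mono) auto
  moreover have "inner (x - y) (p - q) \<le> ?e * norm (p - q)"
    by (rule norm_cauchy_schwarz)
  moreover have "h * (\<alpha> + l * \<beta>) * ?e\<^sup>2 \<le> 0"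
  proof -
    have "l * \<beta> \<le> 1 * \<beta>" using l \<beta> by (intro mult_right_mono) auto
    then show ?thesis using \<alpha> h by (intro mult_nonpos_nonneg mult_nonneg_nonpos) auto
  qed
  ultimately have "?e * ?e \<le> ?e * (norm (p - q) + h * \<beta> * norm (c - d))"
    using implicit_step_difference_bound[where f = f, OF mono lip h x y]
    by (simp add: algebra_simps power2_eq_square)
  with False show ?thesis by (simp add: mult_le_cancel_left)
qed (use h \<beta> in auto)

section \<open>Measurability by factorization and up to null sets\<close>

text \<open>Equal data force equal values, so on \<open>S\<close> the map \<open>x\<close> factors
  through \<open>b\<close>. The factor is Lipschitz on the image of \<open>S\<close> and extends
  continuously to the closure, which is a Borel set whatever \<open>S\<close> is.\<close>

lemma lipschitz_factor_measurable:
  fixes b :: "'a \<Rightarrow> 'c::euclidean_space" and x :: "'a \<Rightarrow> 'b::euclidean_space"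
  assumes "\<And>\<omega> \<omega>'. \<omega> \<in> S \<Longrightarrow> \<omega>' \<in> S \<Longrightarrow> dist (x \<omega>) (x \<omega>') \<le> L * dist (b \<omega>) (b \<omega>')"
    and L: "0 \<le> L"
  obtains \<phi> where "\<phi> \<in> borel_measurable borel" "\<And>\<omega>. \<omega> \<in> S \<Longrightarrow> x \<omega> = \<phi> (b \<omega>)"
proof -
  define \<psi> where "\<psi> = x \<circ> inv_into S b"
  have \<psi>: "\<psi> (b \<omega>) = x \<omega>" if "\<omega> \<in> S" for \<omega>
    using assms(1)[of "inv_into S b (b \<omega>)" \<omega>] that
    by (simp add: \<psi>_def inv_into_into f_inv_into_f)
  have "L-lipschitz_on (b ` S) \<psi>"
    using assms by (intro lipschitz_onI) (auto simp: \<psi>)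
  then have "uniformly_continuous_on (b ` S) \<psi>"
    by (rule lipschitz_on_uniformly_continuous)
  from uniformly_continuous_on_extension_on_closure[OF this] obtain g
    where g: "uniformly_continuous_on (closure (b ` S)) g" "\<And>y. y \<in> b ` S \<Longrightarrow> \<psi> y = g y"
    by metis
  \<comment> \<open>Off the closure the value 0 is a mere default; no data from \<open>S\<close> lie
    there.\<close>
  let ?\<phi> = "\<lambda>y. indicator (closure (b ` S)) y *\<^sub>R g y"
  show thesis
  proof (rule that)
    show "?\<phi> \<in> borel_measurable borel"
      using g(1) by (intro borel_measurable_continuous_on_indicator uniformly_continuous_imp_continuous) auto
    show "x \<omega> = ?\<phi> (b \<omega>)" if "\<omega> \<in> S" for \<omega>
      using that closure_subset[of "b ` S"] g(2)[of "b \<omega>"] \<psi>[OF that] by (auto simp: indicator_def)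
  qed
qed

text \<open>The two maps differ only inside a null set, and by completeness each of its subsets is
  null, hence in \<open>G\<close>. This is what lets a scheme that holds only almost everywhere have
  measurable values.\<close>

lemma (in complete_measure) measurable_AE_modification:
  assumes G: "subalgebra M G" and null: "null_sets M \<subseteq> sets G"
    and y: "y \<in> measurable G N" and sp: "x \<in> space M \<rightarrow> space N" and eq: "AE \<omega> in M. x \<omega> = y \<omega>"
  shows "x \<in> measurable G N"
proof (rule measurableI)
  have spG: "space G = space M" using G by (simp add: subalgebra_def)
  then show "x \<omega> \<in> space N" if "\<omega> \<in> space G" for \<omega> using sp that by auto
  fix B assume B: "B \<in> sets N"
  from eq obtain N0 where N0: "N0 \<in> null_sets M" "{\<omega> \<in> space M. x \<omega> \<noteq> y \<omega>} \<subseteq> N0"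
    by (auto elim!: AE_E simp: null_sets_def)
  have "x -` B \<inter> space G = ((y -` B \<inter> space G) - N0) \<union> (x -` B \<inter> space G \<inter> N0)"
    using N0 spG by auto
  moreover have "x -` B \<inter> space G \<inter> N0 \<in> sets G"
    using null complete2[OF _ N0(1), of "x -` B \<inter> space G \<inter> N0"] by auto
  moreover have "y -` B \<inter> space G \<in> sets G" using y B by (rule measurable_sets)
  moreover have "N0 \<in> sets G" using null N0(1) by auto
  ultimately show "x -` B \<inter> space G \<in> sets G" by (metis sets.Diff sets.Un)
qed

section \<open>Independence and Wiener increments\<close>

lemma (in prob_space) indep_sigma_algebras_expectation_mult:
  fixes P Q :: "'a \<Rightarrow> real"
  assumes ind: "indep_set (sets G) (sets H)" and G: "subalgebra M G" and H: "subalgebra M H"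
    and P: "P \<in> borel_measurable G" and Q: "Q \<in> borel_measurable H"
    and iP: "integrable M P" and iQ: "integrable M Q"
  shows "integrable M (\<lambda>\<omega>. P \<omega> * Q \<omega>)"
    and "expectation (\<lambda>\<omega>. P \<omega> * Q \<omega>) = expectation P * expectation Q"
proof -
  have sub: "sigma_sets (space M) {X -` A \<inter> space M |A. A \<in> sets borel} \<subseteq> sets K"
    if "subalgebra M K" "X \<in> borel_measurable K" for X :: "'a \<Rightarrow> real" and K
  proof -
    have "space M = space K" using that by (simp add: subalgebra_def)
    then show ?thesis
      using measurable_sets[OF that(2)] by (auto intro!: sets.sigma_sets_subset)
  qed
  have "indep_set (sigma_sets (space M) {P -` A \<inter> space M |A. A \<in> sets borel})
      (sigma_sets (space M) {Q -` A \<inter> space M |A. A \<in> sets borel})"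
    using ind sub[OF G P] sub[OF H Q] unfolding indep_set_def
    by (elim indep_sets_mono_sets) (auto split: bool.splits)
  then have "indep_var borel P borel Q"
    using iP iQ by (auto simp: indep_var_eq)
  then show "integrable M (\<lambda>\<omega>. P \<omega> * Q \<omega>)"
    and "expectation (\<lambda>\<omega>. P \<omega> * Q \<omega>) = expectation P * expectation Q"
    using iP iQ by (auto intro: indep_var_integrable indep_var_lebesgue_integral)
qed

lemma integrable_inner_of_squares:
  fixes P Q :: "'a \<Rightarrow> 'b::euclidean_space"
  assumes [measurable]: "P \<in> borel_measurable M" "Q \<in> borel_measurable M"
    and i: "integrable M (\<lambda>\<omega>. (norm (P \<omega>))\<^sup>2)" "integrable M (\<lambda>\<omega>. (norm (Q \<omega>))\<^sup>2)"
  shows "integrable M (\<lambda>\<omega>. inner (P \<omega>) (Q \<omega>))"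
proof (rule Bochner_Integration.integrable_bound[OF Bochner_Integration.integrable_add[OF i]])
  show "AE \<omega> in M. norm (inner (P \<omega>) (Q \<omega>)) \<le> norm ((norm (P \<omega>))\<^sup>2 + (norm (Q \<omega>))\<^sup>2)"
  proof (rule AE_I2)
    fix \<omega>
    have "\<bar>inner (P \<omega>) (Q \<omega>)\<bar> \<le> norm (P \<omega>) * norm (Q \<omega>)" by (rule Cauchy_Schwarz_ineq2)
    moreover have "2 * norm (P \<omega>) * norm (Q \<omega>) \<le> (norm (P \<omega>))\<^sup>2 + (norm (Q \<omega>))\<^sup>2"
      by (rule sum_squares_bound)
    moreover have "0 \<le> norm (P \<omega>) * norm (Q \<omega>)" by simp
    ultimately have "\<bar>inner (P \<omega>) (Q \<omega>)\<bar> \<le> (norm (P \<omega>))\<^sup>2 + (norm (Q \<omega>))\<^sup>2" by linarith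
    then show "norm (inner (P \<omega>) (Q \<omega>)) \<le> norm ((norm (P \<omega>))\<^sup>2 + (norm (Q \<omega>))\<^sup>2)" by simp
  qed
qed simp

text \<open>A one-step Ito isometry. Expand the square: every coefficient is
  \<open>G\<close>-measurable and every factor \<open>r j\<close> or \<open>r j * r k\<close> is
  \<open>H\<close>-measurable, so expectations factor. Mean zero removes the terms linear in
  \<open>r\<close>, and the covariance keeps only the diagonal of the quadratic ones.\<close>

lemma (in prob_space) expectation_norm_sq_add_indep:
  fixes Z :: "'a \<Rightarrow> 'b::euclidean_space" and C :: "'m::finite \<Rightarrow> 'a \<Rightarrow> 'b" and r :: "'m \<Rightarrow> 'a \<Rightarrow> real"
  assumes ind: "indep_set (sets G) (sets H)" and G: "subalgebra M G" and H: "subalgebra M H"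
    and Z: "Z \<in> borel_measurable G" and C: "\<And>j. C j \<in> borel_measurable G"
    and r [measurable]: "\<And>j. r j \<in> borel_measurable H"
    and ir: "\<And>j. integrable M (r j)" and irr: "\<And>j k. integrable M (\<lambda>\<omega>. r j \<omega> * r k \<omega>)"
    and mean: "\<And>j. expectation (r j) = 0"
    and cov: "\<And>j k. expectation (\<lambda>\<omega>. r j \<omega> * r k \<omega>) = (if j = k then h else 0)"
    and iZ: "integrable M (\<lambda>\<omega>. (norm (Z \<omega>))\<^sup>2)" and iC: "\<And>j. integrable M (\<lambda>\<omega>. (norm (C j \<omega>))\<^sup>2)"
  shows "integrable M (\<lambda>\<omega>. (norm (Z \<omega> + (\<Sum>j\<in>UNIV. r j \<omega> *\<^sub>R C j \<omega>)))\<^sup>2)"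
    and "expectation (\<lambda>\<omega>. (norm (Z \<omega> + (\<Sum>j\<in>UNIV. r j \<omega> *\<^sub>R C j \<omega>)))\<^sup>2)
      = expectation (\<lambda>\<omega>. (norm (Z \<omega>))\<^sup>2) + h * (\<Sum>j\<in>UNIV. expectation (\<lambda>\<omega>. (norm (C j \<omega>))\<^sup>2))"
proof -
  note ZM = measurable_from_subalg[OF G Z] and CM = measurable_from_subalg[OF G C]
  have ex: "(norm (Z \<omega> + (\<Sum>j\<in>UNIV. r j \<omega> *\<^sub>R C j \<omega>)))\<^sup>2 = (norm (Z \<omega>))\<^sup>2
      + 2 * (\<Sum>j\<in>UNIV. inner (Z \<omega>) (C j \<omega>) * r j \<omega>)
      + (\<Sum>j\<in>UNIV. \<Sum>k\<in>UNIV. inner (C j \<omega>) (C k \<omega>) * (r j \<omega> * r k \<omega>))" for \<omega>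
    by (simp add: power2_norm_eq_inner inner_add_left inner_add_right inner_sum_left inner_sum_right
        sum_distrib_left inner_commute sum.distrib mult_ac)
  have ZC: "integrable M (\<lambda>\<omega>. inner (Z \<omega>) (C j \<omega>))" for j
    using ZM CM iZ iC by (intro integrable_inner_of_squares)
  have CC: "integrable M (\<lambda>\<omega>. inner (C j \<omega>) (C k \<omega>))" for j k
    using CM iC by (intro integrable_inner_of_squares)
  note A = indep_sigma_algebras_expectation_mult[OF ind G H _ r ZC ir]
  note B = indep_sigma_algebras_expectation_mult[OF ind G H _ _ CC irr]
  have A1: "integrable M (\<lambda>\<omega>. inner (Z \<omega>) (C j \<omega>) * r j \<omega>)"
    and A2: "expectation (\<lambda>\<omega>. inner (Z \<omega>) (C j \<omega>) * r j \<omega>) = 0" for j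
    using A[of j j] Z C mean by auto
  have B1: "integrable M (\<lambda>\<omega>. inner (C j \<omega>) (C k \<omega>) * (r j \<omega> * r k \<omega>))"
    and B2: "expectation (\<lambda>\<omega>. inner (C j \<omega>) (C k \<omega>) * (r j \<omega> * r k \<omega>))
      = (if j = k then h * expectation (\<lambda>\<omega>. (norm (C j \<omega>))\<^sup>2) else 0)" for j k
    using B[of j k j k] C cov by (auto simp: power2_norm_eq_inner)
  show "integrable M (\<lambda>\<omega>. (norm (Z \<omega> + (\<Sum>j\<in>UNIV. r j \<omega> *\<^sub>R C j \<omega>)))\<^sup>2)"
    unfolding ex using iZ A1 B1 by auto
  show "expectation (\<lambda>\<omega>. (norm (Z \<omega> + (\<Sum>j\<in>UNIV. r j \<omega> *\<^sub>R C j \<omega>)))\<^sup>2)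
      = expectation (\<lambda>\<omega>. (norm (Z \<omega>))\<^sup>2) + h * (\<Sum>j\<in>UNIV. expectation (\<lambda>\<omega>. (norm (C j \<omega>))\<^sup>2))"
    unfolding ex using iZ A1 B1
    by (simp add: A2 B2 sum_distrib_left)
qed

lemma wiener_process_increment:
  fixes w :: "real \<Rightarrow> 'a \<Rightarrow> real ^ 'm"
  assumes "prob_space M" and "usual_filtration M a F" and W: "wiener_process M a F w" and st: "a \<le> s" "s < t"
  defines "H \<equiv> vimage_algebra (space M) (\<lambda>\<omega>. w t \<omega> - w s \<omega>) borel"
    and "r \<equiv> \<lambda>j \<omega>. (w t \<omega> - w s \<omega>) $ j"
  shows "subalgebra M H" and "prob_space.indep_set M (sets (F s)) (sets H)"
    and "r j \<in> borel_measurable H"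
    and "integrable M (r j)" and "integrable M (\<lambda>\<omega>. r j \<omega> * r k \<omega>)"
    and "prob_space.expectation M (r j) = 0"
    and "prob_space.expectation M (\<lambda>\<omega>. r j \<omega> * r k \<omega>) = (if j = k then t - s else 0)"
proof -
  interpret prob_space M by fact
  have F: "subalgebra M (F u)" if "u \<ge> a" for u
    using that assms(2) by (simp add: usual_filtration_def)
  have [measurable]: "w u \<in> borel_measurable M" if "u \<ge> a" for u
    using that W measurable_from_subalg[OF F] by (auto simp: wiener_process_def)
  have [measurable]: "w s \<in> borel_measurable M" "w t \<in> borel_measurable M"
    using st by auto
  show "subalgebra M H"
    unfolding subalgebra_def H_def by (auto simp: sets_vimage_algebra2)
  show "indep_set (sets (F s)) (sets H)"
    using W st by (simp add: wiener_process_def H_def)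
  have "(\<lambda>\<omega>. w t \<omega> - w s \<omega>) \<in> borel_measurable H"
    unfolding H_def by (rule measurable_vimage_algebra1) auto
  moreover have "(\<lambda>v::real^'m. v $ j) \<in> borel_measurable borel"
    by (intro borel_measurable_continuous_onI continuous_intros)
  ultimately show "r j \<in> borel_measurable H"
    unfolding r_def by (rule measurable_compose)
  have D: "distributed M lborel (r j) (normal_density 0 (sqrt (t - s)))" for j
    using W st by (simp add: wiener_process_def r_def)
  have pos: "0 < sqrt (t - s)" using st by simp
  have I: "integrable M (r j)" for j
    using integrable_normal_moment_nz_1[OF pos, of 0] 
    by (subst distributed_integrable[OF D, of "\<lambda>x. x", symmetric]) auto
  show "integrable M (r j)" by (rule I)
  have E: "expectation (r j) = 0" for j
    by (rule normal_distributed_expectation[OF pos D])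
  show "expectation (r j) = 0" by (rule E)
  have I2: "integrable M (\<lambda>\<omega>. (r j \<omega>)\<^sup>2)" for j
    using integrable_normal_moment[OF pos, of 0 2]
    by (subst distributed_integrable[OF D, of "\<lambda>x. x\<^sup>2", symmetric]) auto
  have E2: "expectation (\<lambda>\<omega>. (r j \<omega>)\<^sup>2) = t - s" for j
    using normal_distributed_variance[OF pos D, of j] st by (simp add: E)
  have V: "indep_var borel (r j) borel (r k)" if "j \<noteq> k" for j k
  proof -
    have "indep_vars (\<lambda>_. borel) r UNIV" using W st by (simp add: wiener_process_def r_def)
    \<comment> \<open>Joint independence of the coordinates is restricted to two singleton index
      sets; evaluating at the single index then gives the pair.\<close>
    from indep_var_restrict[OF this, of "{j}" "{k}"] that
    have "indep_var (PiM {j} (\<lambda>_. borel)) (\<lambda>\<omega>. restrict (\<lambda>i. r i \<omega>) {j})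
        (PiM {k} (\<lambda>_. borel)) (\<lambda>\<omega>. restrict (\<lambda>i. r i \<omega>) {k})" by simp
    from indep_var_compose[OF this, of "\<lambda>v. v j" borel "\<lambda>v. v k" borel]
    show ?thesis by (simp add: comp_def)
  qed
  show "integrable M (\<lambda>\<omega>. r j \<omega> * r k \<omega>)"
    using I2[of j] indep_var_integrable[OF V I I, of j k] by (cases "j = k") (auto simp: power2_eq_square)
  show "expectation (\<lambda>\<omega>. r j \<omega> * r k \<omega>) = (if j = k then t - s else 0)"
    using E2[of j] indep_var_lebesgue_integral[OF V I I, of j k] E by (auto simp: power2_eq_square)
qed

section \<open>The interpolant as a convex combination of grid values\<close>

text \<open>Index and weight are the floor and the fractional part of \<open>(s - a) / h\<close>, so
  they depend on the time alone. The inner quantifier records this: the same weights serve both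
  solutions, and interpolation commutes with taking their difference.\<close>

lemma interpolant_convex_combination:
  assumes "h > 0" and "a < s"
  obtains m \<theta> where "0 \<le> \<theta>" "\<theta> < 1" "s = a + (real m + \<theta>) * h"
    "\<forall>(\<xi> :: real \<Rightarrow> 'a \<Rightarrow> complex ^ 'd) X \<omega>.
      interpolant a h \<xi> X s \<omega> = (1 - \<theta>) *\<^sub>R X m \<omega> + \<theta> *\<^sub>R X (Suc m) \<omega>"
proof
  define m \<theta> where "m = nat \<lfloor>(s - a) / h\<rfloor>" and "\<theta> = frac ((s - a) / h)"
  show "0 \<le> \<theta>" "\<theta> < 1" by (simp_all add: \<theta>_def frac_lt_1)
  have "real m + \<theta> = (s - a) / h"
    using assms by (simp add: m_def \<theta>_def frac_def)
  then show s: "s = a + (real m + \<theta>) * h"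
    using assms by (simp add: field_simps)
  show "\<forall>(\<xi> :: real \<Rightarrow> 'a \<Rightarrow> complex ^ 'd) X \<omega>.
      interpolant a h \<xi> X s \<omega> = (1 - \<theta>) *\<^sub>R X m \<omega> + \<theta> *\<^sub>R X (Suc m) \<omega>"
  proof (intro allI)
    fix \<xi> :: "real \<Rightarrow> 'a \<Rightarrow> complex ^ 'd" and X \<omega>
    have "grid a h (Suc m) - s = h * (1 - \<theta>)" "s - grid a h m = h * \<theta>"
      unfolding s grid_def by (simp_all add: algebra_simps)
    then show "interpolant a h \<xi> X s \<omega> = (1 - \<theta>) *\<^sub>R X m \<omega> + \<theta> *\<^sub>R X (Suc m) \<omega>"
      using assms unfolding interpolant_def Let_def m_def[symmetric]
      by (simp add: scaleR_add_right)
  qed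
qed

lemma interpolant_past:
  assumes h: "h > 0" and s: "a < s" "s \<le> grid a h n" "grid a h N \<le> s"
  obtains i j \<theta> where "N \<le> i" "i \<le> n" "N \<le> j" "j \<le> n" "0 \<le> \<theta>" "\<theta> \<le> 1"
    "\<forall>(\<xi> :: real \<Rightarrow> 'a \<Rightarrow> complex ^ 'd) X \<omega>.
      interpolant a h \<xi> X s \<omega> = (1 - \<theta>) *\<^sub>R X i \<omega> + \<theta> *\<^sub>R X j \<omega>"
proof -
  obtain m \<theta> where m: "0 \<le> \<theta>" "\<theta> < 1" "s = a + (real m + \<theta>) * h"
    "\<forall>(\<xi> :: real \<Rightarrow> 'a \<Rightarrow> complex ^ 'd) X \<omega>.
      interpolant a h \<xi> X s \<omega> = (1 - \<theta>) *\<^sub>R X m \<omega> + \<theta> *\<^sub>R X (Suc m) \<omega>"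
    by (rule interpolant_convex_combination[OF h s(1), where 'a='a and 'd='d])
  have le: "real m + \<theta> \<le> real n" "real N \<le> real m + \<theta>"
    using s h unfolding m(3) grid_def by auto
  then have "m \<le> n" "N \<le> m" using m(1,2) by linarith+
  show thesis
  proof (cases "m = n")
    \<comment> \<open>Here \<open>s\<close> is the grid point \<open>n\<close> itself, and the
      formula names the later value \<open>X (Suc n)\<close> with weight 0. Repeating the index
      \<open>m\<close> keeps both indices in the past.\<close>
    case True
    with le m have "\<theta> = 0" by simp
    then show ?thesis
      using \<open>m \<le> n\<close> \<open>N \<le> m\<close> by (intro that[of m m 0]) (simp_all add: m(4))
  next
    case False
    then show ?thesis
      using \<open>m \<le> n\<close> \<open>N \<le> m\<close> m(1,2) by (intro that[of m "Suc m" \<theta>]) (simp_all add: m(4))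
  qed
qed

text \<open>\<open>l\<close> is the weight on the unknown \<open>X (Suc n)\<close>: 0 if
  \<open>s\<close> lies in the past, \<theta> if it lies inside the last cell, and 1 if it is the
  new grid point. In the last case the past part has weight 0 and \<open>n\<close> is only a
  placeholder for its indices.\<close>

lemma interpolant_implicit:
  assumes h: "h > 0" and s: "a < s" "s \<le> grid a h (Suc n)" "grid a h N \<le> s" and N: "N \<le> n"
  obtains i j \<theta> l where "N \<le> i" "i \<le> n" "N \<le> j" "j \<le> n" "0 \<le> \<theta>" "\<theta> \<le> 1" "0 \<le> l" "l \<le> 1"
    "\<forall>(\<xi> :: real \<Rightarrow> 'a \<Rightarrow> complex ^ 'd) X \<omega>. interpolant a h \<xi> X s \<omega>
      = (1 - l) *\<^sub>R ((1 - \<theta>) *\<^sub>R X i \<omega> + \<theta> *\<^sub>R X j \<omega>) + l *\<^sub>R X (Suc n) \<omega>"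
proof (cases "s \<le> grid a h n")
  case True
  obtain i j \<theta> where "N \<le> i" "i \<le> n" "N \<le> j" "j \<le> n" "0 \<le> \<theta>" "\<theta> \<le> 1"
    "\<forall>(\<xi> :: real \<Rightarrow> 'a \<Rightarrow> complex ^ 'd) X \<omega>.
      interpolant a h \<xi> X s \<omega> = (1 - \<theta>) *\<^sub>R X i \<omega> + \<theta> *\<^sub>R X j \<omega>"
    by (rule interpolant_past[OF h s(1) True s(3), where 'a='a and 'd='d])
  then show ?thesis using N by (intro that[of i j \<theta> 0]) simp_all
next
  case False
  obtain m \<theta> where m: "0 \<le> \<theta>" "\<theta> < 1" "s = a + (real m + \<theta>) * h"
    "\<forall>(\<xi> :: real \<Rightarrow> 'a \<Rightarrow> complex ^ 'd) X \<omega>.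
      interpolant a h \<xi> X s \<omega> = (1 - \<theta>) *\<^sub>R X m \<omega> + \<theta> *\<^sub>R X (Suc m) \<omega>"
    by (rule interpolant_convex_combination[OF h s(1), where 'a='a and 'd='d])
  have "real m + \<theta> \<le> real (Suc n)" "real n < real m + \<theta>"
    using s h False unfolding m(3) grid_def by auto
  then have "m = n \<or> m = Suc n \<and> \<theta> = 0" using m(1,2) by linarith
  then show ?thesis
  proof
    assume "m = n"
    then show ?thesis using N m(1,2) by (intro that[of n n 0 \<theta>]) (simp_all add: m(4))
  next
    assume "m = Suc n \<and> \<theta> = 0"
    then show ?thesis using N by (intro that[of n n 0 1]) (simp_all add: m(4))
  qed
qed

lemma interpolant_measurable:
  fixes X :: "nat \<Rightarrow> 'a \<Rightarrow> complex ^ 'd"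
  assumes h: "h > 0" and s: "s \<le> grid a h n"
    and \<xi>: "s \<le> a \<Longrightarrow> \<xi> s \<in> borel_measurable G" and X: "\<And>m. m \<le> n \<Longrightarrow> X m \<in> borel_measurable G"
  shows "interpolant a h \<xi> X s \<in> borel_measurable G"
proof (cases "s \<le> a")
  case True
  then have "interpolant a h \<xi> X s = \<xi> s" by (simp add: interpolant_def fun_eq_iff)
  then show ?thesis using \<xi>[OF True] by simp
next
  case False
  then have "a < s" "grid a h 0 \<le> s" by (auto simp: grid_def)
  then obtain i j \<theta> where ij: "0 \<le> i" "i \<le> n" "0 \<le> j" "j \<le> n" "0 \<le> \<theta>" "\<theta> \<le> 1" and
    "\<forall>(\<xi> :: real \<Rightarrow> 'a \<Rightarrow> complex ^ 'd) X \<omega>.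
      interpolant a h \<xi> X s \<omega> = (1 - \<theta>) *\<^sub>R X i \<omega> + \<theta> *\<^sub>R X j \<omega>"
    by (rule interpolant_past[OF h _ s, where 'a='a and 'd='d])
  then have "interpolant a h \<xi> X s = (\<lambda>\<omega>. (1 - \<theta>) *\<^sub>R X i \<omega> + \<theta> *\<^sub>R X j \<omega>)"
    by (simp add: fun_eq_iff)
  then show ?thesis using X[OF ij(2)] X[OF ij(4)] by simp
qed

section \<open>Adaptedness of the scheme\<close>

lemma measurable_filtration_mono:
  assumes "usual_filtration M a F" "a \<le> s" "s \<le> t" "Z \<in> borel_measurable (F s)"
  shows "Z \<in> borel_measurable (F t)"
proof (rule measurable_from_subalg[OF _ assms(4)])
  show "subalgebra (F t) (F s)"
    using assms unfolding usual_filtration_def subalgebra_def by (metis order_trans)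
qed

lemma borel_measurable_section_compose:
  fixes k :: "real \<Rightarrow> 'b::euclidean_space \<Rightarrow> 'c::euclidean_space \<Rightarrow> 'e::euclidean_space"
  assumes "continuous_on ({a..} \<times> UNIV \<times> UNIV) (\<lambda>(t, x, y). k t x y)" and "a \<le> t"
    and "x \<in> borel_measurable G" "y \<in> borel_measurable G"
  shows "(\<lambda>\<omega>. k t (x \<omega>) (y \<omega>)) \<in> borel_measurable G"
proof -
  have "continuous_on UNIV (\<lambda>z. (\<lambda>(t, x, y). k t x y) (t, fst z, snd z))"
    using assms(2) by (intro continuous_on_compose2[OF assms(1)] continuous_intros) auto
  from borel_measurable_continuous_onI[OF this]
  have "(\<lambda>z. k t (fst z) (snd z)) \<in> borel_measurable borel" by (simp add: case_prod_unfold)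
  from measurable_compose[OF borel_measurable_Pair[OF assms(3,4)] this] show ?thesis by simp
qed

lemma borel_measurable_noise_term:
  fixes A :: "'a \<Rightarrow> complex ^ 'm ^ 'd" and v :: "'a \<Rightarrow> real ^ 'm"
  assumes "A \<in> borel_measurable G" "v \<in> borel_measurable G"
  shows "(\<lambda>\<omega>. A \<omega> *v (\<chi> j. complex_of_real (v \<omega> $ j))) \<in> borel_measurable G"
proof -
  have "(\<lambda>z :: (complex ^ 'm ^ 'd) \<times> (real ^ 'm). fst z *v (\<chi> j. complex_of_real (snd z $ j)))
      \<in> borel_measurable borel"
    unfolding matrix_vector_mult_def
    by (intro borel_measurable_continuous_onI continuous_intros)
  from measurable_compose[OF borel_measurable_Pair[OF assms] this] show ?thesis by simp
qed

text \<open>The induction carries all earlier indices, since a delay may reach back arbitrarily far.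
  In each step the explicit data are gathered in a pair \<open>(b, V)\<close> that is measurable at
  the new time, and the new value is almost everywhere a Borel function of this pair.\<close>

lemma backward_euler_adapted:
  fixes f :: "real \<Rightarrow> complex ^ 'd \<Rightarrow> complex ^ 'd \<Rightarrow> complex ^ 'd"
    and g :: "real \<Rightarrow> complex ^ 'd \<Rightarrow> complex ^ 'd \<Rightarrow> complex ^ 'm ^ 'd"
  assumes cM: "complete_measure M" and F: "usual_filtration M a F" and W: "wiener_process M a F w"
    and \<tau>: "\<forall>t\<ge>a. \<tau> t \<ge> 0" "\<forall>t\<ge>a. t - \<tau> t \<ge> a - \<tau>0"
    and cg: "continuous_on ({a..} \<times> UNIV \<times> UNIV) (\<lambda>(t, x, y). g t x y)"
    and mono: "\<And>t x y u. t \<ge> a \<Longrightarrow> inner (x - y) (f t x u - f t y u) \<le> \<alpha> * (norm (x - y))\<^sup>2"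
    and lip: "\<And>t x u v. t \<ge> a \<Longrightarrow> norm (f t x u - f t x v) \<le> \<beta> * norm (u - v)"
    and \<beta>: "0 \<le> \<beta>" and \<alpha>: "\<alpha> + \<beta> \<le> 0"
    and \<xi>: "\<And>u. u \<in> {a - \<tau>0..a} \<Longrightarrow> \<xi> u \<in> borel_measurable (F a)" and \<tau>0: "0 \<le> \<tau>0"
    and h: "h > 0" and X: "backward_euler M a \<tau> f g w h \<xi> X"
  shows "X n \<in> borel_measurable (F (grid a h n))"
proof -
  interpret complete_measure M by fact
  have sub: "subalgebra M (F t)" and null: "null_sets M \<subseteq> sets (F t)" if "t \<ge> a" for t
    using F that unfolding usual_filtration_def by (blast, meson order_refl order_trans)
  have grid: "a \<le> grid a h n" "m \<le> n \<Longrightarrow> grid a h m \<le> grid a h n" for m n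
    using h by (auto simp: grid_def)
  have "\<forall>m\<le>n. X m \<in> borel_measurable (F (grid a h m))"
  proof (induction n)
    case 0
    have "X 0 \<in> borel_measurable (F a)"
      using X \<tau>0 by (intro measurable_AE_modification[OF sub null \<xi>[of a]]) (auto simp: backward_euler_def)
    then show ?case by (simp add: grid_def)
  next
    case (Suc n)
    let ?t = "grid a h n" and ?t' = "grid a h (Suc n)"
    let ?s = "?t - \<tau> ?t" and ?s' = "?t' - \<tau> ?t'"
    have Xm: "X m \<in> borel_measurable (F t)" if "m \<le> n" "?t \<le> t" for m t
      using Suc that grid by (meson measurable_filtration_mono[OF F] order_trans)
    have \<xi>m: "\<xi> u \<in> borel_measurable (F t)" if "a - \<tau>0 \<le> u" "u \<le> a" "a \<le> t" for u t
      using \<xi>[of u] that by (intro measurable_filtration_mono[OF F _ _ \<xi>]) auto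
    have s: "a - \<tau>0 \<le> ?s" "?s \<le> ?t" "a - \<tau>0 \<le> ?s'" "?s' \<le> ?t'"
      using \<tau> grid by auto
    have U: "interpolant a h \<xi> X ?s \<in> borel_measurable (F ?t)"
      using s(1) by (intro interpolant_measurable[OF h s(2)] \<xi>m grid(1) Xm) auto
    \<comment> \<open>\<open>V\<close> is the known part of the delayed argument, separated from the
      share \<open>l\<close> of the unknown.\<close>
    obtain l V where l: "0 \<le> l" "l \<le> 1" and V [measurable]: "V \<in> borel_measurable (F ?t')"
      and eqV: "\<And>\<omega>. interpolant a h \<xi> X ?s' \<omega> = V \<omega> + l *\<^sub>R X (Suc n) \<omega>"
    proof (cases "?s' \<le> a")
      case True
      then show ?thesis using \<xi>m[OF s(3) True grid(1)]
        by (intro that[of 0 "\<xi> ?s'"]) (auto simp: interpolant_def)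
    next
      case False
      then have "a < ?s'" "grid a h 0 \<le> ?s'" by (auto simp: grid_def)
      then obtain i j \<theta> l where ij: "0 \<le> i" "i \<le> n" "0 \<le> j" "j \<le> n" and "0 \<le> \<theta>" "\<theta> \<le> 1" and l: "0 \<le> l" "l \<le> 1" and
        *: "\<forall>(\<xi> :: real \<Rightarrow> 'a \<Rightarrow> complex ^ 'd) X \<omega>. interpolant a h \<xi> X ?s' \<omega>
          = (1 - l) *\<^sub>R ((1 - \<theta>) *\<^sub>R X i \<omega> + \<theta> *\<^sub>R X j \<omega>) + l *\<^sub>R X (Suc n) \<omega>"
        by (rule interpolant_implicit[OF h _ s(4) _ le0, where 'a='a and 'd='d])
      have [measurable]: "X i \<in> borel_measurable (F ?t')" "X j \<in> borel_measurable (F ?t')"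
        using ij grid by (auto intro: Xm)
      show ?thesis
        by (rule that[OF l, of "\<lambda>\<omega>. (1 - l) *\<^sub>R ((1 - \<theta>) *\<^sub>R X i \<omega> + \<theta> *\<^sub>R X j \<omega>)"]) (simp_all add: *[rule_format])
    qed
    let ?A = "\<lambda>\<omega>. g ?t (X n \<omega>) (interpolant a h \<xi> X ?s \<omega>)"
    define b where "b = (\<lambda>\<omega>. X n \<omega> + ?A \<omega> *v (\<chi> j. complex_of_real ((w ?t' \<omega> - w ?t \<omega>) $ j)))"
    have A: "?A \<in> borel_measurable (F ?t)"
      using Xm[of n ?t] by (intro borel_measurable_section_compose[OF cg grid(1) _ U]) auto
    have w [measurable]: "w ?t \<in> borel_measurable (F ?t')" "w ?t' \<in> borel_measurable (F ?t')"
      using W grid by (auto simp: wiener_process_def intro!: measurable_filtration_mono[OF F grid(1), of n ?t'])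
    have "(\<lambda>\<omega>. w ?t' \<omega> - w ?t \<omega>) \<in> borel_measurable (F ?t')" by simp
    from borel_measurable_noise_term[OF measurable_filtration_mono[OF F grid(1) grid(2) A] this]
    have b [measurable]: "b \<in> borel_measurable (F ?t')"
      unfolding b_def using Xm[of n ?t'] grid by (intro borel_measurable_add) auto
    \<comment> \<open>At points of \<open>S\<close> the same implicit equation holds with data
      \<open>(b, V)\<close>. The Lipschitz estimate is applied to the values of one solution at two
      sample points of \<open>S\<close>, not to two solutions.\<close>
    define S where "S = {\<omega> \<in> space M. X (Suc n) \<omega> = b \<omega> + h *\<^sub>R f ?t' (X (Suc n) \<omega>) (V \<omega> + l *\<^sub>R X (Suc n) \<omega>)}"
    have "AE \<omega> in M. X (Suc n) \<omega> = X n \<omega>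
          + h *\<^sub>R f ?t' (X (Suc n) \<omega>) (interpolant a h \<xi> X ?s' \<omega>)
          + ?A \<omega> *v (\<chi> j. complex_of_real ((w ?t' \<omega> - w ?t \<omega>) $ j))"
      using X unfolding backward_euler_def by blast
    then have S: "AE \<omega> in M. \<omega> \<in> S"
      by (rule AE_mp) (auto intro!: AE_I2 simp: S_def b_def eqV add_ac)
    have "dist (X (Suc n) \<omega>) (X (Suc n) \<omega>') \<le> (1 + h * \<beta>) * dist (b \<omega>, V \<omega>) (b \<omega>', V \<omega>')"
      if "\<omega> \<in> S" "\<omega>' \<in> S" for \<omega> \<omega>'
    proof -
      have "norm (X (Suc n) \<omega> - X (Suc n) \<omega>') \<le> norm (b \<omega> - b \<omega>') + h * \<beta> * norm (V \<omega> - V \<omega>')"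
        using that h by (intro implicit_step_lipschitz[where f="f ?t'", OF mono lip _ \<beta> \<alpha> l])
          (auto simp: S_def grid)
      also have "\<dots> \<le> dist (b \<omega>, V \<omega>) (b \<omega>', V \<omega>') + h * \<beta> * dist (b \<omega>, V \<omega>) (b \<omega>', V \<omega>')"
        using h \<beta> dist_fst_le[of "(b \<omega>, V \<omega>)" "(b \<omega>', V \<omega>')"] dist_snd_le[of "(b \<omega>, V \<omega>)" "(b \<omega>', V \<omega>')"]
        by (intro add_mono mult_left_mono) (auto simp: dist_norm)
      finally show ?thesis by (simp add: dist_norm algebra_simps)
    qed
    then obtain \<phi> where \<phi>: "\<phi> \<in> borel_measurable borel" "\<And>\<omega>. \<omega> \<in> S \<Longrightarrow> X (Suc n) \<omega> = \<phi> (b \<omega>, V \<omega>)"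
      using lipschitz_factor_measurable[of S "X (Suc n)" "1 + h * \<beta>" "\<lambda>\<omega>. (b \<omega>, V \<omega>)"] h \<beta> by auto
    have \<phi>m: "(\<lambda>\<omega>. \<phi> (b \<omega>, V \<omega>)) \<in> borel_measurable (F ?t')"
      by (rule measurable_compose[OF borel_measurable_Pair \<phi>(1)]) fact+
    have \<phi>_eq: "AE \<omega> in M. X (Suc n) \<omega> = \<phi> (b \<omega>, V \<omega>)"
      using S by eventually_elim (rule \<phi>(2))
    have "X (Suc n) \<in> borel_measurable (F ?t')"
      by (rule measurable_AE_modification[OF sub[OF grid(1)] null[OF grid(1)] \<phi>m _ \<phi>_eq]) simp
    with Suc show ?case by (auto simp: le_Suc_eq)
  qed
  then show ?thesis by blast
qed

section \<open>Mean-square estimates\<close>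

lemma mean_square_leD:
  assumes [measurable]: "Z \<in> borel_measurable M" and K: "mean_square M Z \<le> ennreal K" "0 \<le> K"
  shows "integrable M (\<lambda>\<omega>. (norm (Z \<omega>))\<^sup>2)" and "integral\<^sup>L M (\<lambda>\<omega>. (norm (Z \<omega>))\<^sup>2) \<le> K"
proof -
  show i: "integrable M (\<lambda>\<omega>. (norm (Z \<omega>))\<^sup>2)"
    using K(1) by (intro integrableI_nonneg) (auto simp: mean_square_def intro: le_less_trans)
  show "integral\<^sup>L M (\<lambda>\<omega>. (norm (Z \<omega>))\<^sup>2) \<le> K"
    using K nn_integral_eq_integral[OF i] by (simp add: mean_square_def)
qed

text \<open>The gap between the two sides is exactly \<open>(1 - \<theta>) * \<theta>\<close> times
  the squared distance of \<open>x\<close> and \<open>y\<close>.\<close>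

lemma norm_sq_convex:
  fixes x y :: "'b::real_inner"
  assumes "0 \<le> \<theta>" "\<theta> \<le> 1"
  shows "(norm ((1 - \<theta>) *\<^sub>R x + \<theta> *\<^sub>R y))\<^sup>2 \<le> (1 - \<theta>) * (norm x)\<^sup>2 + \<theta> * (norm y)\<^sup>2"
proof -
  have "0 \<le> (1 - \<theta>) * \<theta> * (norm (x - y))\<^sup>2" using assms by simp
  also have "\<dots> = (1 - \<theta>) * (norm x)\<^sup>2 + \<theta> * (norm y)\<^sup>2 - (norm ((1 - \<theta>) *\<^sub>R x + \<theta> *\<^sub>R y))\<^sup>2"
    by (simp add: power2_norm_eq_inner inner_add_left inner_add_right inner_diff_left inner_diff_right
        inner_commute algebra_simps)
  finally show ?thesis by simp
qed

text \<open>Convexity of the squared norm makes interpolation free of cost: a bound on differences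
  at grid points passes to delayed values with the same \<open>K\<close>.\<close>

lemma mean_square_convex:
  assumes [measurable]: "Z \<in> borel_measurable M" "Z' \<in> borel_measurable M" and \<theta>: "0 \<le> \<theta>" "\<theta> \<le> 1"
    and K: "mean_square M Z \<le> ennreal K" "mean_square M Z' \<le> ennreal K" "0 \<le> K"
  shows "mean_square M (\<lambda>\<omega>. (1 - \<theta>) *\<^sub>R Z \<omega> + \<theta> *\<^sub>R Z' \<omega>) \<le> ennreal K"
proof -
  note Z = mean_square_leD[OF assms(1) K(1,3)] and Z' = mean_square_leD[OF assms(2) K(2,3)]
  have "mean_square M (\<lambda>\<omega>. (1 - \<theta>) *\<^sub>R Z \<omega> + \<theta> *\<^sub>R Z' \<omega>)
      \<le> (\<integral>\<^sup>+\<omega>. ennreal ((1 - \<theta>) * (norm (Z \<omega>))\<^sup>2 + \<theta> * (norm (Z' \<omega>))\<^sup>2) \<partial>M)"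
    unfolding mean_square_def using \<theta> by (intro nn_integral_mono ennreal_leI norm_sq_convex)
  also have "\<dots> = ennreal ((1 - \<theta>) * integral\<^sup>L M (\<lambda>\<omega>. (norm (Z \<omega>))\<^sup>2) + \<theta> * integral\<^sup>L M (\<lambda>\<omega>. (norm (Z' \<omega>))\<^sup>2))"
    using Z(1) Z'(1) \<theta> by (subst nn_integral_eq_integral) auto
  also have "\<dots> \<le> ennreal ((1 - \<theta>) * K + \<theta> * K)"
    using Z(2) Z'(2) \<theta> by (intro ennreal_leI add_mono mult_left_mono) auto
  finally show ?thesis by (simp add: algebra_simps)
qed

text \<open>Brings the noise into the form of scalar increments times vectors that the isometry
  expects; the squared column norms then add up to the squared Frobenius norm.\<close>

lemma noise_term_eq_sum_columns:
  fixes A :: "complex ^ 'm ^ 'd"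
  shows "A *v (\<chi> j. complex_of_real (r j)) = (\<Sum>j\<in>UNIV. r j *\<^sub>R column j A)"
  by (simp add: vec_eq_iff matrix_vector_mult_def column_def scaleR_conv_of_real[where 'a=complex] mult.commute)

lemma norm_sq_eq_sum_columns:
  fixes A :: "complex ^ 'm ^ 'd"
  shows "(norm A)\<^sup>2 = (\<Sum>j\<in>UNIV. (norm (column j A))\<^sup>2)"
  by (simp add: power2_norm_eq_inner inner_vec_def column_def) (rule sum.swap)

lemma expectation_euler_increment_le:
  fixes w :: "real \<Rightarrow> 'a \<Rightarrow> real ^ 'm" and Z U :: "'a \<Rightarrow> complex ^ 'd" and A :: "'a \<Rightarrow> complex ^ 'm ^ 'd"
  assumes pM: "prob_space M" and F: "usual_filtration M a F" and W: "wiener_process M a F w"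
    and st: "a \<le> s" "s < t"
    and Z: "Z \<in> borel_measurable (F s)" and U: "U \<in> borel_measurable (F s)"
    and A: "A \<in> borel_measurable (F s)"
    and A_le: "\<And>\<omega>. norm (A \<omega>) \<le> \<gamma>1 * norm (Z \<omega>) + \<gamma>2 * norm (U \<omega>)" and \<gamma>: "0 \<le> \<gamma>1" "0 \<le> \<gamma>2"
    and K: "mean_square M Z \<le> ennreal K" "mean_square M U \<le> ennreal K" "0 \<le> K"
  defines "P \<equiv> \<lambda>\<omega>. Z \<omega> + A \<omega> *v (\<chi> j. complex_of_real ((w t \<omega> - w s \<omega>) $ j))"
  shows "integrable M (\<lambda>\<omega>. (norm (P \<omega>))\<^sup>2)"
    and "prob_space.expectation M (\<lambda>\<omega>. (norm (P \<omega>))\<^sup>2) \<le> (1 + (t - s) * (\<gamma>1 + \<gamma>2)\<^sup>2) * K"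
proof -
  interpret prob_space M by fact
  have sub: "subalgebra M (F s)" using F st by (simp add: usual_filtration_def)
  note ZM = measurable_from_subalg[OF sub Z] and UM = measurable_from_subalg[OF sub U]
    and AM [measurable] = measurable_from_subalg[OF sub A]
  note Zi = mean_square_leD[OF ZM K(1,3)] and Ui = mean_square_leD[OF UM K(2,3)]
  \<comment> \<open>The coefficients come from expanding the square of the Lipschitz bound and
    splitting the mixed product evenly by Young. They add up to the square of
    \<open>\<gamma>1 + \<gamma>2\<close>.\<close>
  let ?B = "\<lambda>\<omega>. (\<gamma>1 * (\<gamma>1 + \<gamma>2)) * (norm (Z \<omega>))\<^sup>2 + (\<gamma>2 * (\<gamma>1 + \<gamma>2)) * (norm (U \<omega>))\<^sup>2"
  have AB: "(norm (A \<omega>))\<^sup>2 \<le> ?B \<omega>" for \<omega>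
  proof -
    have "(norm (A \<omega>))\<^sup>2 \<le> (\<gamma>1 * norm (Z \<omega>) + \<gamma>2 * norm (U \<omega>))\<^sup>2"
      using A_le by (intro power_mono) auto
    also have "\<dots> \<le> ?B \<omega>"
    proof -
      have "0 \<le> \<gamma>1 * \<gamma>2 * (norm (Z \<omega>) - norm (U \<omega>))\<^sup>2" using \<gamma> by simp
      then show ?thesis by (simp add: power2_eq_square algebra_simps)
    qed
    finally show ?thesis .
  qed
  have Bi: "integrable M ?B" using Zi Ui by auto
  have Ai: "integrable M (\<lambda>\<omega>. (norm (A \<omega>))\<^sup>2)"
    using AB by (intro Bochner_Integration.integrable_bound[OF Bi])
      (auto intro!: AE_I2 order_trans[OF AB] simp: abs_le_iff)
  have "expectation (\<lambda>\<omega>. (norm (A \<omega>))\<^sup>2) \<le> expectation ?B"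
    using AB by (intro integral_mono Ai Bi)
  also have "\<dots> = \<gamma>1 * (\<gamma>1 + \<gamma>2) * expectation (\<lambda>\<omega>. (norm (Z \<omega>))\<^sup>2)
      + \<gamma>2 * (\<gamma>1 + \<gamma>2) * expectation (\<lambda>\<omega>. (norm (U \<omega>))\<^sup>2)"
    using Zi Ui by simp
  also have "\<dots> \<le> \<gamma>1 * (\<gamma>1 + \<gamma>2) * K + \<gamma>2 * (\<gamma>1 + \<gamma>2) * K"
    using Zi Ui \<gamma> by (intro add_mono mult_left_mono) auto
  finally have A_exp: "expectation (\<lambda>\<omega>. (norm (A \<omega>))\<^sup>2) \<le> (\<gamma>1 + \<gamma>2)\<^sup>2 * K"
    by (simp add: power2_eq_square algebra_simps)
  have C: "(\<lambda>\<omega>. column j (A \<omega>)) \<in> borel_measurable (F s)" for j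
  proof -
    have "(\<lambda>A :: complex ^ 'm ^ 'd. column j A) \<in> borel_measurable borel"
      unfolding column_def by (intro borel_measurable_continuous_onI continuous_intros)
    from measurable_compose[OF A this] show ?thesis .
  qed
  have Ci: "integrable M (\<lambda>\<omega>. (norm (column j (A \<omega>)))\<^sup>2)" for j
  proof (rule Bochner_Integration.integrable_bound[OF Ai])
    show "(\<lambda>\<omega>. (norm (column j (A \<omega>)))\<^sup>2) \<in> borel_measurable M"
      using measurable_from_subalg[OF sub C] by measurable
    show "AE \<omega> in M. norm ((norm (column j (A \<omega>)))\<^sup>2) \<le> norm ((norm (A \<omega>))\<^sup>2)"
      by (auto intro!: AE_I2 member_le_sum[of j UNIV "\<lambda>j. (norm (column j (A _)))\<^sup>2"]
          simp: norm_sq_eq_sum_columns sum_nonneg)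
  qed
  note w = wiener_process_increment[OF pM F W st]
  note E = expectation_norm_sq_add_indep[where C = "\<lambda>j \<omega>. column j (A \<omega>)",
      OF w(2) sub w(1) Z C w(3) w(4) w(5) w(6) w(7) Zi(1) Ci]
  have P: "P \<omega> = Z \<omega> + (\<Sum>j\<in>UNIV. ((w t \<omega> - w s \<omega>) $ j) *\<^sub>R column j (A \<omega>))" for \<omega>
    unfolding P_def noise_term_eq_sum_columns ..
  show "integrable M (\<lambda>\<omega>. (norm (P \<omega>))\<^sup>2)" unfolding P by (rule E(1))
  have "expectation (\<lambda>\<omega>. (norm (P \<omega>))\<^sup>2)
      = expectation (\<lambda>\<omega>. (norm (Z \<omega>))\<^sup>2) + (t - s) * expectation (\<lambda>\<omega>. (norm (A \<omega>))\<^sup>2)"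
    unfolding P E(2) using Ci by (simp add: norm_sq_eq_sum_columns)
  also have "\<dots> \<le> K + (t - s) * ((\<gamma>1 + \<gamma>2)\<^sup>2 * K)"
    using Zi(2) A_exp st by (intro add_mono mult_left_mono) auto
  finally show "expectation (\<lambda>\<omega>. (norm (P \<omega>))\<^sup>2) \<le> (1 + (t - s) * (\<gamma>1 + \<gamma>2)\<^sup>2) * K"
    by (simp add: algebra_simps)
qed

section \<open>Constants and initial data\<close>

lemma SD_classD:
  fixes f :: "real \<Rightarrow> complex ^ 'd \<Rightarrow> complex ^ 'd \<Rightarrow> complex ^ 'd"
    and g :: "real \<Rightarrow> complex ^ 'd \<Rightarrow> complex ^ 'd \<Rightarrow> complex ^ 'm ^ 'd"
  assumes S: "SD_class a f g \<alpha> \<beta> \<gamma>1 \<gamma>2"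
  shows "t \<ge> a \<Longrightarrow> inner (x - y) (f t x u - f t y u) \<le> \<alpha> * (norm (x - y))\<^sup>2"
    and "t \<ge> a \<Longrightarrow> norm (f t x u - f t x v) \<le> \<beta> * norm (u - v)"
    and "t \<ge> a \<Longrightarrow> norm (g t x u - g t y v) \<le> \<gamma>1 * norm (x - y) + \<gamma>2 * norm (u - v)"
    and "0 \<le> \<beta>" "0 \<le> \<gamma>1" "0 \<le> \<gamma>2"
proof -
  show "t \<ge> a \<Longrightarrow> inner (x - y) (f t x u - f t y u) \<le> \<alpha> * (norm (x - y))\<^sup>2"
    using S unfolding SD_class_def Re_cinner_eq_inner by blast
  have f: "t \<ge> a \<Longrightarrow> norm (f t x u - f t x v) \<le> \<beta> * norm (u - v)" for t x u v
    using S unfolding SD_class_def by blast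
  then show "t \<ge> a \<Longrightarrow> norm (f t x u - f t x v) \<le> \<beta> * norm (u - v)" .
  have g: "t \<ge> a \<Longrightarrow> norm (g t x u - g t y v) \<le> \<gamma>1 * norm (x - y) + \<gamma>2 * norm (u - v)" for t x y u v
    using S unfolding SD_class_def by blast
  then show "t \<ge> a \<Longrightarrow> norm (g t x u - g t y v) \<le> \<gamma>1 * norm (x - y) + \<gamma>2 * norm (u - v)" .
  \<comment> \<open>Any nonzero vector would do: a Lipschitz bound tested on it forces its constant
    to be nonnegative.\<close>
  define e :: "complex ^ 'd" where "e = (\<chi> i. 1)"
  have e: "0 < norm (e - 0)" by (simp add: e_def vec_eq_iff)
  have "0 \<le> \<beta> * norm (e - 0)" "0 \<le> \<gamma>1 * norm (e - 0)" "0 \<le> \<gamma>2 * norm (e - 0)"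
    using order_trans[OF norm_ge_zero f[of a 0 e 0]] order_trans[OF norm_ge_zero g[of a e 0 0 0]]
      order_trans[OF norm_ge_zero g[of a 0 e 0 0]] by auto
  with e show "0 \<le> \<beta>" "0 \<le> \<gamma>1" "0 \<le> \<gamma>2" by (simp_all add: zero_le_mult_iff)
qed

text \<open>Adding the same amount to both parts moves a quotient below 1 towards 1. It serves
  twice: to identify the maximum in \<open>c2\<close>, and to bound the factor of a step uniformly
  in the share \<open>l\<close>.\<close>

lemma mediant_mono:
  fixes N D b b' :: real
  assumes "0 < D" "N \<le> D" "0 \<le> b" "b \<le> b'"
  shows "(N + b) / (D + b) \<le> (N + b') / (D + b')"
proof -
  have "0 \<le> (D - N) * (b' - b)" using assms by simp
  then show ?thesis using assms by (simp add: divide_le_eq pos_le_divide_eq frac_le_eq field_simps)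
qed

text \<open>On a probability space, squares are dominated by 1 plus the \<open>p\<close>-th power as
  \<open>p > 2\<close>. Finiteness of the supremum lets the later estimates run with a real bound
  \<open>K\<close>.\<close>

lemma Lp_paths_mean_square_bounded:
  assumes pM: "prob_space M" and G: "subalgebra M G" and p: "p > 2"
    and \<xi>: "\<xi> \<in> Lp_paths p M G t1 t2" and \<eta>: "\<eta> \<in> Lp_paths p M G t1 t2"
  shows "(SUP t\<in>{t1..t2}. mean_square M (\<lambda>\<omega>. \<xi> t \<omega> - \<eta> t \<omega>)) < \<infinity>"
proof -
  interpret prob_space M by fact
  have sq: "x\<^sup>2 \<le> 1 + x powr p" if "0 \<le> x" for x :: real
  proof (cases "x \<le> 1")
    case True
    with that have "x\<^sup>2 \<le> 1" by (simp add: power_le_one)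
    then show ?thesis by (simp add: add_increasing2)
  next
    case False
    then have "x\<^sup>2 = x powr 2" by simp
    also have "\<dots> \<le> x powr p" using False p by (intro powr_mono) auto
    finally show ?thesis by simp
  qed
  let ?S = "\<lambda>\<psi>. SUP u\<in>{t1..t2}. \<integral>\<^sup>+ \<omega>. ennreal (norm (\<psi> u \<omega>) powr p) \<partial>M"
  have "mean_square M (\<lambda>\<omega>. \<xi> t \<omega> - \<eta> t \<omega>) \<le> 2 * (1 + ?S \<xi>) + 2 * (1 + ?S \<eta>)" if t: "t \<in> {t1..t2}" for t
  proof -
    have [measurable]: "\<xi> t \<in> borel_measurable M" "\<eta> t \<in> borel_measurable M"
      using \<xi> \<eta> t by (auto simp: Lp_paths_def intro: measurable_from_subalg[OF G])
    have "mean_square M (\<lambda>\<omega>. \<xi> t \<omega> - \<eta> t \<omega>)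
        \<le> (\<integral>\<^sup>+ \<omega>. 2 * (1 + ennreal (norm (\<xi> t \<omega>) powr p)) + 2 * (1 + ennreal (norm (\<eta> t \<omega>) powr p)) \<partial>M)"
      unfolding mean_square_def
    proof (intro nn_integral_mono)
      fix \<omega>
      let ?x = "norm (\<xi> t \<omega>)" and ?y = "norm (\<eta> t \<omega>)"
      have "(norm (\<xi> t \<omega> - \<eta> t \<omega>))\<^sup>2 \<le> (?x + ?y)\<^sup>2"
        by (intro power_mono norm_triangle_ineq4) auto
      also have "\<dots> \<le> 2 * ?x\<^sup>2 + 2 * ?y\<^sup>2"
        using sum_squares_bound[of ?x ?y] by (simp add: power2_sum)
      also have "\<dots> \<le> 2 * (1 + ?x powr p) + 2 * (1 + ?y powr p)"
        by (intro add_mono mult_left_mono sq) auto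
      finally have "ennreal ((norm (\<xi> t \<omega> - \<eta> t \<omega>))\<^sup>2) \<le> ennreal (2 * (1 + ?x powr p) + 2 * (1 + ?y powr p))"
        by (rule ennreal_leI)
      also have "\<dots> = 2 * (1 + ennreal (?x powr p)) + 2 * (1 + ennreal (?y powr p))"
        by (simp add: ennreal_plus ennreal_mult)
      finally show "ennreal ((norm (\<xi> t \<omega> - \<eta> t \<omega>))\<^sup>2)
        \<le> 2 * (1 + ennreal (?x powr p)) + 2 * (1 + ennreal (?y powr p))" .
    qed
    also have "\<dots> = 2 * (1 + (\<integral>\<^sup>+ \<omega>. ennreal (norm (\<xi> t \<omega>) powr p) \<partial>M))
        + 2 * (1 + (\<integral>\<^sup>+ \<omega>. ennreal (norm (\<eta> t \<omega>) powr p) \<partial>M))"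
      by (simp add: nn_integral_add nn_integral_cmult emeasure_space_1)
    also have "\<dots> \<le> 2 * (1 + ?S \<xi>) + 2 * (1 + ?S \<eta>)"
      using t by (intro add_mono mult_left_mono order_refl SUP_upper) auto
    finally show ?thesis .
  qed
  then have "(SUP t\<in>{t1..t2}. mean_square M (\<lambda>\<omega>. \<xi> t \<omega> - \<eta> t \<omega>)) \<le> 2 * (1 + ?S \<xi>) + 2 * (1 + ?S \<eta>)"
    by (rule SUP_least)
  also have "\<dots> < \<infinity>"
    using \<xi> \<eta> by (auto simp: Lp_paths_def ennreal_mult_less_top)
  finally show ?thesis .
qed

section \<open>Contraction of a step and decay along the delay\<close>

theorem theorem4p4:
  fixes M :: "'a measure" and F :: "real \<Rightarrow> 'a measure"
    and w :: "real \<Rightarrow> 'a \<Rightarrow> real ^ 'm"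
    and f :: "real \<Rightarrow> complex ^ 'd \<Rightarrow> complex ^ 'd \<Rightarrow> complex ^ 'd"
    and g :: "real \<Rightarrow> complex ^ 'd \<Rightarrow> complex ^ 'd \<Rightarrow> complex ^ 'm ^ 'd"
    and \<tau> :: "real \<Rightarrow> real"
    and \<xi> \<eta> :: "real \<Rightarrow> 'a \<Rightarrow> complex ^ 'd"
    and X Y :: "nat \<Rightarrow> 'a \<Rightarrow> complex ^ 'd"
    and a \<tau>0 p \<alpha> \<beta> \<gamma>1 \<gamma>2 h c2 :: real
  assumes "prob_space M" and "complete_measure M"
    and "usual_filtration M a F"
    and "wiener_process M a F w"
    and "p > 2" and "\<tau>0 \<ge> 0"
    and "\<forall>t\<ge>a. \<tau> t \<ge> 0"
    and "\<forall>t\<ge>a. t - \<tau> t \<ge> a - \<tau>0"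
    and "continuous_on ({a..} \<times> UNIV \<times> UNIV) (\<lambda>(t, x, y). f t x y)"
    and "continuous_on ({a..} \<times> UNIV \<times> UNIV) (\<lambda>(t, x, y). g t x y)"
    and "SD_class a f g \<alpha> \<beta> \<gamma>1 \<gamma>2"
    and "filterlim (\<lambda>t. t - \<tau> t) at_top at_top"
    and "2 * \<alpha> + 2 * \<beta> + \<gamma>1\<^sup>2 + 2 * \<gamma>1 * \<gamma>2 + \<gamma>2\<^sup>2 < 0"
    and "\<xi> \<in> Lp_paths p M (F a) (a - \<tau>0) a"
    and "\<eta> \<in> Lp_paths p M (F a) (a - \<tau>0) a"
    and "h > 0"
    and "backward_euler M a \<tau> f g w h \<xi> X"
    and "backward_euler M a \<tau> f g w h \<eta> Y"
    and c2: "c2 = max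
      ((1 + h * \<gamma>1\<^sup>2 + 2 * h * \<gamma>1 * \<gamma>2 + h * \<gamma>2\<^sup>2) / (1 - 2 * h * \<alpha> - 2 * h * \<beta>))
      ((1 + h * \<beta> + h * \<gamma>1\<^sup>2 + 2 * h * \<gamma>1 * \<gamma>2 + h * \<gamma>2\<^sup>2) / (1 - 2 * h * \<alpha> - h * \<beta>))"
  shows "c2 = (1 + h * \<beta> + h * \<gamma>1\<^sup>2 + 2 * h * \<gamma>1 * \<gamma>2 + h * \<gamma>2\<^sup>2) / (1 - 2 * h * \<alpha> - h * \<beta>)
    \<and> c2 < 1
    \<and> (\<exists>n :: nat \<Rightarrow> nat. strict_mono n \<and> filterlim n at_top sequentially \<and> n 0 = 0 \<and>
         (\<forall>k. (MAX i\<in>{n k<..n (Suc k)}. mean_square M (\<lambda>\<omega>. X i \<omega> - Y i \<omega>))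
            \<le> ennreal (c2 ^ Suc k) *
                (SUP t\<in>{a - \<tau>0..a}. mean_square M (\<lambda>\<omega>. \<xi> t \<omega> - \<eta> t \<omega>))))
    \<and> (\<lambda>n. mean_square M (\<lambda>\<omega>. X n \<omega> - Y n \<omega>)) \<longlonglongrightarrow> 0"
proof -
  interpret prob_space M by fact
  note FF = assms(3) and W = assms(4) and \<tau>0 = assms(6) and \<tau> = assms(7,8) and cg = assms(10)
    and lim = assms(12) and h = \<open>h > 0\<close> and bX = assms(17) and bY = assms(18)
  note SD = SD_classD[OF assms(11)]
  note \<beta> = SD(4) and \<gamma> = SD(5,6)
  \<comment> \<open>\<open>N0 / D0\<close> is the first quotient in \<open>c2\<close>, and adding
    \<open>h * \<beta>\<close> above and below gives the second. The sign condition on the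
    constants, multiplied by \<open>h\<close>, says exactly \<open>N0 < D0\<close>.\<close>
  define \<Gamma> where "\<Gamma> = (\<gamma>1 + \<gamma>2)\<^sup>2"
  define N0 where "N0 = 1 + h * \<Gamma>"
  define D0 where "D0 = 1 - 2 * h * \<alpha> - 2 * h * \<beta>"
  have \<Gamma>: "0 \<le> \<Gamma>" "2 * \<alpha> + 2 * \<beta> + \<Gamma> < 0"
    using assms(13) unfolding \<Gamma>_def by (simp, simp add: power2_sum)
  then have \<alpha>\<beta>: "\<alpha> + \<beta> \<le> 0" by linarith
  have "h * (2 * \<alpha> + 2 * \<beta> + \<Gamma>) < 0" using \<Gamma> h by (simp add: mult_pos_neg)
  then have ND: "N0 < D0" by (simp add: N0_def D0_def algebra_simps)
  have N0: "0 < N0" using \<Gamma> h by (simp add: N0_def add_pos_nonneg)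
  have h\<beta>: "0 \<le> h * \<beta>" using h \<beta> by simp
  have c2': "c2 = (N0 + h * \<beta>) / (D0 + h * \<beta>)"
    "c2 = (1 + h * \<beta> + h * \<gamma>1\<^sup>2 + 2 * h * \<gamma>1 * \<gamma>2 + h * \<gamma>2\<^sup>2) / (1 - 2 * h * \<alpha> - h * \<beta>)"
  proof -
    have *: "1 + h * \<gamma>1\<^sup>2 + 2 * h * \<gamma>1 * \<gamma>2 + h * \<gamma>2\<^sup>2 = N0"
      "1 + h * \<beta> + h * \<gamma>1\<^sup>2 + 2 * h * \<gamma>1 * \<gamma>2 + h * \<gamma>2\<^sup>2 = N0 + h * \<beta>"
      "1 - 2 * h * \<alpha> - 2 * h * \<beta> = D0" "1 - 2 * h * \<alpha> - h * \<beta> = D0 + h * \<beta>"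
      by (simp_all add: N0_def D0_def \<Gamma>_def power2_sum algebra_simps)
    have "N0 / D0 \<le> (N0 + h * \<beta>) / (D0 + h * \<beta>)"
      using mediant_mono[of D0 N0 0 "h * \<beta>"] N0 ND h\<beta> by simp
    then show "c2 = (N0 + h * \<beta>) / (D0 + h * \<beta>)"
      "c2 = (1 + h * \<beta> + h * \<gamma>1\<^sup>2 + 2 * h * \<gamma>1 * \<gamma>2 + h * \<gamma>2\<^sup>2) / (1 - 2 * h * \<alpha> - h * \<beta>)"
      unfolding c2 * by simp_all
  qed
  have c2_01: "0 < c2" "c2 < 1"
    unfolding c2'(1) using N0 ND h\<beta> by (simp_all add: divide_less_eq)
  let ?ms = "mean_square M"
  define Z where "Z = (\<lambda>n \<omega>. X n \<omega> - Y n \<omega>)"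
  define \<zeta> where "\<zeta> = (\<lambda>t \<omega>. \<xi> t \<omega> - \<eta> t \<omega>)"
  define t where "t = grid a h"
  define s where "s = (\<lambda>n. t n - \<tau> (t n))"
  define I where "I = (\<lambda>u. interpolant a h \<xi> X u)"
  define J where "J = (\<lambda>u. interpolant a h \<eta> Y u)"
  have t: "a \<le> t n" "t (Suc n) = t n + h" "t n < t (Suc n)" for n
    using h by (simp_all add: t_def grid_def algebra_simps)
  have t_mono: "t m \<le> t n" if "m \<le> n" for m n
    using that h by (simp add: t_def grid_def)
  have s: "a - \<tau>0 \<le> s n" "s n \<le> t n" for n using \<tau> t(1) by (simp_all add: s_def)
  have sub: "subalgebra M (F u)" if "u \<ge> a" for u using FF that by (simp add: usual_filtration_def)
  have \<xi>\<eta>: "\<xi> u \<in> borel_measurable (F a)" "\<eta> u \<in> borel_measurable (F a)" if "u \<in> {a - \<tau>0..a}" for u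
    using assms(14,15) that by (auto simp: Lp_paths_def)
  have adapted: "V n \<in> borel_measurable (F (t n))"
    if "\<And>u. u \<in> {a - \<tau>0..a} \<Longrightarrow> \<psi> u \<in> borel_measurable (F a)" "backward_euler M a \<tau> f g w h \<psi> V" for \<psi> V n
    unfolding t_def
    by (rule backward_euler_adapted[where f=f, OF assms(2) FF W \<tau> cg _ _ \<beta> \<alpha>\<beta> that(1) \<tau>0 h that(2)])
      (erule SD)+
  have XY: "X n \<in> borel_measurable (F (t n))" "Y n \<in> borel_measurable (F (t n))" for n
    using adapted[OF \<xi>\<eta>(1) bX] adapted[OF \<xi>\<eta>(2) bY] by auto
  have Z: "Z n \<in> borel_measurable (F (t n))" for n using XY by (simp add: Z_def)
  have ZF: "Z m \<in> borel_measurable (F (t n))" if "m \<le> n" for m n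
    by (rule measurable_filtration_mono[OF FF t(1) t_mono[OF that] Z])
  have ZM: "Z n \<in> borel_measurable M" for n by (rule measurable_from_subalg[OF sub[OF t(1)] Z])
  have \<zeta>: "\<zeta> u \<in> borel_measurable (F (t n))" if "a - \<tau>0 \<le> u" "u \<le> a" for u n
    by (rule measurable_filtration_mono[OF FF order_refl t(1)]) (use that \<xi>\<eta>[of u] in \<open>simp add: \<zeta>_def\<close>)
  have \<zeta>M: "\<zeta> u \<in> borel_measurable M" if "a - \<tau>0 \<le> u" "u \<le> a" for u
    using measurable_from_subalg[OF sub[OF t(1)] \<zeta>[OF that]] .

  \<comment> \<open>The one-step contraction. \<open>past\<close> concerns both delayed times in
    play, index \<open>n\<close> in the diffusion and \<open>Suc n\<close> in the drift: each lies
    in the initial interval with controlled data, or not before \<open>t N\<close>, so that only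
    indices from \<open>N\<close> on are consulted.\<close>
  have step: "?ms (Z (Suc n)) \<le> ennreal (c2 * K)"
    if K: "0 \<le> K" and N: "N \<le> n" and ZK: "\<And>i. N \<le> i \<Longrightarrow> i \<le> n \<Longrightarrow> ?ms (Z i) \<le> ennreal K"
      and past: "\<And>m. m = n \<or> m = Suc n \<Longrightarrow> (s m \<le> a \<and> ?ms (\<zeta> (s m)) \<le> ennreal K) \<or> (a < s m \<and> t N \<le> s m)"
    for n N K
  proof -
    let ?U = "\<lambda>\<omega>. I (s n) \<omega> - J (s n) \<omega>"
    have U: "?U \<in> borel_measurable (F (t n)) \<and> ?ms ?U \<le> ennreal K"
    proof (cases "s n \<le> a")
      case True
      then have "?U = \<zeta> (s n)" by (simp add: I_def J_def \<zeta>_def interpolant_def fun_eq_iff)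
      then show ?thesis using True past[of n] \<zeta>[OF s(1) True] by auto
    next
      case False
      then have "a < s n" "t N \<le> s n" using past[of n] by auto
      then obtain i j \<theta> where ij: "N \<le> i" "i \<le> n" "N \<le> j" "j \<le> n" and \<theta>: "0 \<le> \<theta>" "\<theta> \<le> 1" and
        *: "\<forall>(\<xi> :: real \<Rightarrow> 'a \<Rightarrow> complex ^ 'd) X \<omega>.
          interpolant a h \<xi> X (s n) \<omega> = (1 - \<theta>) *\<^sub>R X i \<omega> + \<theta> *\<^sub>R X j \<omega>"
        by (rule interpolant_past[OF h _ s(2)[unfolded t_def], folded t_def, where 'a='a and 'd='d])
      have "?U = (\<lambda>\<omega>. (1 - \<theta>) *\<^sub>R Z i \<omega> + \<theta> *\<^sub>R Z j \<omega>)"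
        by (simp add: I_def J_def Z_def *[rule_format] algebra_simps)
      then show ?thesis
        using mean_square_convex[OF ZM ZM \<theta> ZK ZK K] ij ZF[OF ij(2)] ZF[OF ij(4)] by simp
    qed
    \<comment> \<open>The delayed difference at the new time, with the share \<open>l\<close> of the
      unknown \<open>Z (Suc n)\<close> split off.\<close>
    obtain l V where l: "0 \<le> l" "l \<le> 1" and VM: "V \<in> borel_measurable M" and VK: "?ms V \<le> ennreal K"
      and U': "\<And>\<omega>. I (s (Suc n)) \<omega> - J (s (Suc n)) \<omega> = (1 - l) *\<^sub>R V \<omega> + l *\<^sub>R Z (Suc n) \<omega>"
    proof (cases "s (Suc n) \<le> a")
      case True
      show ?thesis
        using True past[of "Suc n"] \<zeta>M[OF s(1) True]
        by (intro that[of 0 "\<zeta> (s (Suc n))"]) (auto simp: I_def J_def \<zeta>_def interpolant_def)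
    next
      case False
      then have "a < s (Suc n)" "t N \<le> s (Suc n)" using past[of "Suc n"] by auto
      then obtain i j \<theta> l where ij: "N \<le> i" "i \<le> n" "N \<le> j" "j \<le> n" and \<theta>: "0 \<le> \<theta>" "\<theta> \<le> 1"
        and l: "0 \<le> l" "l \<le> 1" and *: "\<forall>(\<xi> :: real \<Rightarrow> 'a \<Rightarrow> complex ^ 'd) X \<omega>. interpolant a h \<xi> X (s (Suc n)) \<omega>
          = (1 - l) *\<^sub>R ((1 - \<theta>) *\<^sub>R X i \<omega> + \<theta> *\<^sub>R X j \<omega>) + l *\<^sub>R X (Suc n) \<omega>"
        by (rule interpolant_implicit[OF h _ s(2)[unfolded t_def] _ N, folded t_def, where 'a='a and 'd='d])
      show ?thesis
      proof (rule that[OF l])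
        show "(\<lambda>\<omega>. (1 - \<theta>) *\<^sub>R Z i \<omega> + \<theta> *\<^sub>R Z j \<omega>) \<in> borel_measurable M"
          using ZM[of i] ZM[of j] by simp
        show "?ms (\<lambda>\<omega>. (1 - \<theta>) *\<^sub>R Z i \<omega> + \<theta> *\<^sub>R Z j \<omega>) \<le> ennreal K"
          using mean_square_convex[OF ZM ZM \<theta> ZK ZK K] ij by simp
        show "I (s (Suc n)) \<omega> - J (s (Suc n)) \<omega>
            = (1 - l) *\<^sub>R ((1 - \<theta>) *\<^sub>R Z i \<omega> + \<theta> *\<^sub>R Z j \<omega>) + l *\<^sub>R Z (Suc n) \<omega>" for \<omega>
          by (simp add: I_def J_def Z_def *[rule_format] algebra_simps)
      qed
    qed
    note Vi = mean_square_leD[OF VM VK K]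
    let ?gX = "\<lambda>\<omega>. g (t n) (X n \<omega>) (I (s n) \<omega>)" and ?gY = "\<lambda>\<omega>. g (t n) (Y n \<omega>) (J (s n) \<omega>)"
    let ?v = "\<lambda>\<omega>. (\<chi> j. complex_of_real ((w (t (Suc n)) \<omega> - w (t n) \<omega>) $ j)) :: complex ^ 'm"
    define P where "P = (\<lambda>\<omega>. Z n \<omega> + (?gX \<omega> - ?gY \<omega>) *v ?v \<omega>)"
    have IJ: "I (s n) \<in> borel_measurable (F (t n))" "J (s n) \<in> borel_measurable (F (t n))"
      unfolding I_def J_def using s(1)[of n]
      by (auto simp: t_def[symmetric] intro!: interpolant_measurable[OF h s(2)[of n, unfolded t_def]]
          measurable_filtration_mono[OF FF order_refl t(1) \<xi>\<eta>(1)] measurable_filtration_mono[OF FF order_refl t(1) \<xi>\<eta>(2)]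
          measurable_filtration_mono[OF FF t(1) t_mono XY(1)] measurable_filtration_mono[OF FF t(1) t_mono XY(2)])
    have gm: "(\<lambda>\<omega>. ?gX \<omega> - ?gY \<omega>) \<in> borel_measurable (F (t n))"
      using borel_measurable_section_compose[OF cg t(1) XY(1) IJ(1)]
        borel_measurable_section_compose[OF cg t(1) XY(2) IJ(2)] by simp
    have gl: "norm (?gX \<omega> - ?gY \<omega>) \<le> \<gamma>1 * norm (Z n \<omega>) + \<gamma>2 * norm (I (s n) \<omega> - J (s n) \<omega>)" for \<omega>
      unfolding Z_def by (rule SD(3)[OF t(1)])
    have P: "integrable M (\<lambda>\<omega>. (norm (P \<omega>))\<^sup>2)" "expectation (\<lambda>\<omega>. (norm (P \<omega>))\<^sup>2) \<le> N0 * K"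
      using expectation_euler_increment_le[OF assms(1) FF W t(1) t(3) Z conjunct1[OF U] gm gl \<gamma>
        ZK[OF N order_refl] conjunct2[OF U] K]
      by (simp_all add: P_def t(2) N0_def \<Gamma>_def)
    \<comment> \<open>The weight left on \<open>V\<close>. Moving the \<open>l\<close>-share of the
      delay term to the left turns the factor \<open>D0 + h * \<beta>\<close> there into
      \<open>D0 + b\<close>.\<close>
    define b where "b = h * \<beta> * (1 - l)"
    have b: "0 \<le> b" "b \<le> h * \<beta>" using h\<beta> l by (auto simp: b_def mult_left_le)
    then have Db: "0 < D0 + b" using N0 ND by simp
    have "AE \<omega> in M. X (Suc n) \<omega> = X n \<omega> + h *\<^sub>R f (t (Suc n)) (X (Suc n) \<omega>) (I (s (Suc n)) \<omega>) + ?gX \<omega> *v ?v \<omega>"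
      using bX unfolding backward_euler_def I_def s_def t_def by blast
    moreover have "AE \<omega> in M. Y (Suc n) \<omega> = Y n \<omega> + h *\<^sub>R f (t (Suc n)) (Y (Suc n) \<omega>) (J (s (Suc n)) \<omega>) + ?gY \<omega> *v ?v \<omega>"
      using bY unfolding backward_euler_def J_def s_def t_def by blast
    ultimately have "AE \<omega> in M. (norm (Z (Suc n) \<omega>))\<^sup>2 \<le> (b * (norm (V \<omega>))\<^sup>2 + (norm (P \<omega>))\<^sup>2) / (D0 + b)"
    proof eventually_elim
      fix \<omega>
      assume x: "X (Suc n) \<omega> = X n \<omega> + h *\<^sub>R f (t (Suc n)) (X (Suc n) \<omega>) (I (s (Suc n)) \<omega>) + ?gX \<omega> *v ?v \<omega>"
        and y: "Y (Suc n) \<omega> = Y n \<omega> + h *\<^sub>R f (t (Suc n)) (Y (Suc n) \<omega>) (J (s (Suc n)) \<omega>) + ?gY \<omega> *v ?v \<omega>"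
      have "(1 - 2 * h * \<alpha> - h * \<beta>) * (norm (X (Suc n) \<omega> - Y (Suc n) \<omega>))\<^sup>2
          \<le> h * \<beta> * (norm (I (s (Suc n)) \<omega> - J (s (Suc n)) \<omega>))\<^sup>2
            + (norm ((X n \<omega> + ?gX \<omega> *v ?v \<omega>) - (Y n \<omega> + ?gY \<omega> *v ?v \<omega>)))\<^sup>2"
        by (rule implicit_step_energy[where f="f (t (Suc n))", OF SD(1)[OF t(1)] SD(2)[OF t(1)] less_imp_le[OF h] \<beta>])
          (subst x, simp, subst y, simp)
      also have "(X n \<omega> + ?gX \<omega> *v ?v \<omega>) - (Y n \<omega> + ?gY \<omega> *v ?v \<omega>) = P \<omega>"
        by (simp add: P_def Z_def matrix_vector_mult_diff_rdistrib)
      also have "h * \<beta> * (norm (I (s (Suc n)) \<omega> - J (s (Suc n)) \<omega>))\<^sup>2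
          \<le> h * \<beta> * ((1 - l) * (norm (V \<omega>))\<^sup>2 + l * (norm (Z (Suc n) \<omega>))\<^sup>2)"
        unfolding U' by (intro mult_left_mono norm_sq_convex l h\<beta>)
      finally have "(D0 + b) * (norm (Z (Suc n) \<omega>))\<^sup>2 \<le> b * (norm (V \<omega>))\<^sup>2 + (norm (P \<omega>))\<^sup>2"
        by (simp add: D0_def b_def Z_def algebra_simps)
      then show "(norm (Z (Suc n) \<omega>))\<^sup>2 \<le> (b * (norm (V \<omega>))\<^sup>2 + (norm (P \<omega>))\<^sup>2) / (D0 + b)"
        using Db by (simp add: pos_le_divide_eq mult.commute)
    qed
    then have "?ms (Z (Suc n)) \<le> (\<integral>\<^sup>+\<omega>. ennreal ((b * (norm (V \<omega>))\<^sup>2 + (norm (P \<omega>))\<^sup>2) / (D0 + b)) \<partial>M)"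
      unfolding mean_square_def by (intro nn_integral_mono_AE) (auto elim!: eventually_mono intro: ennreal_leI)
    also have "\<dots> = ennreal ((b * expectation (\<lambda>\<omega>. (norm (V \<omega>))\<^sup>2) + expectation (\<lambda>\<omega>. (norm (P \<omega>))\<^sup>2)) / (D0 + b))"
      using Vi(1) P(1) b Db by (subst nn_integral_eq_integral) auto
    also have "\<dots> \<le> ennreal ((b * K + N0 * K) / (D0 + b))"
      using Vi(2) P(2) b Db by (intro ennreal_leI divide_right_mono add_mono mult_left_mono) auto
    also have "(b * K + N0 * K) / (D0 + b) = (N0 + b) / (D0 + b) * K"
      by (simp add: algebra_simps)
    \<comment> \<open>The case \<open>b = h * \<beta>\<close>, that is \<open>l = 0\<close>, has the
      largest quotient, and it equals \<open>c2\<close>.\<close>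
    also have "ennreal \<dots> \<le> ennreal (c2 * K)"
      unfolding c2'(1) using mediant_mono[of D0 N0 b "h * \<beta>"] N0 ND b K
      by (intro ennreal_leI mult_right_mono) auto
    finally show ?thesis .
  qed

  define S where "S = (SUP u\<in>{a - \<tau>0..a}. ?ms (\<zeta> u))"
  have "S < \<infinity>"
    unfolding S_def \<zeta>_def using Lp_paths_mean_square_bounded[OF assms(1) sub[OF order_refl] assms(5,14,15)] .
  then obtain K where K: "0 \<le> K" "S = ennreal K" by (cases S) auto
  have \<zeta>K: "?ms (\<zeta> u) \<le> ennreal K" if "a - \<tau>0 \<le> u" "u \<le> a" for u
    unfolding K(2)[symmetric] S_def using that by (intro SUP_upper) auto
  \<comment> \<open>With \<open>N = 0\<close> the condition on delayed times always holds, as they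
    lie in the initial interval or after \<open>t 0\<close>, which is \<open>a\<close>. Since
    \<open>c2 < 1\<close>, the bound \<open>K\<close> propagates.\<close>
  have base: "?ms (Z n) \<le> ennreal K" for n
  proof (induction n rule: less_induct)
    case (less n)
    show ?case
    proof (cases n)
      case 0
      have "AE \<omega> in M. X 0 \<omega> = \<xi> a \<omega>" "AE \<omega> in M. Y 0 \<omega> = \<eta> a \<omega>"
        using bX bY by (auto simp: backward_euler_def)
      then have "?ms (Z 0) = ?ms (\<zeta> a)"
        unfolding mean_square_def Z_def \<zeta>_def by (intro nn_integral_cong_AE) auto
      then show ?thesis using \<zeta>K[of a] \<tau>0 0 by simp
    next
      case (Suc m)
      have "?ms (Z (Suc m)) \<le> ennreal (c2 * K)"
        using less Suc s \<zeta>K by (intro step[OF K(1) le0]) (auto simp: t_def grid_def not_le)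
      also have "\<dots> \<le> ennreal K" using c2_01 K(1) by (intro ennreal_leI) (simp add: mult_left_le_one_le)
      finally show ?thesis using Suc by simp
    qed
  qed
  \<comment> \<open>\<open>Suc N\<close> rather than \<open>N\<close>, because the improved bound
    will be known only for indices strictly above \<open>N\<close>. The choice depends on the grid
    of the given \<open>h\<close>.\<close>
  have "\<exists>N'>N. \<forall>m\<ge>N'. t (Suc N) \<le> s m" for N
  proof -
    have "filterlim t at_top sequentially"
      unfolding t_def grid_def
      using h by (intro filterlim_tendsto_add_at_top[OF tendsto_const]
          filterlim_at_top_mult_tendsto_pos[OF tendsto_const] filterlim_real_sequentially)
    from filterlim_compose[OF lim this]
    have "filterlim s at_top sequentially" unfolding s_def .
    then have "eventually (\<lambda>m. t (Suc N) \<le> s m) sequentially" by (simp add: filterlim_at_top)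
    then obtain N1 where "\<forall>m\<ge>N1. t (Suc N) \<le> s m" by (auto simp: eventually_sequentially)
    then show ?thesis by (intro exI[of _ "max N1 (Suc N)"]) auto
  qed
  then obtain nxt where nxt: "\<And>N. N < nxt N" "\<And>N m. nxt N \<le> m \<Longrightarrow> t (Suc N) \<le> s m" by metis
  define n where "n = rec_nat 0 (\<lambda>_. nxt)"
  have n: "n 0 = 0" "n (Suc k) = nxt (n k)" for k by (simp_all add: n_def)
  have n_mono: "strict_mono n" by (intro strict_monoI_Suc) (simp add: n nxt)
  \<comment> \<open>Claimed for all \<open>i\<close> above \<open>n k\<close>, not just up to
    \<open>n (Suc k)\<close>: a later step may consult any index between \<open>Suc (n k)\<close>
    and its own.\<close>
  have decay: "?ms (Z i) \<le> ennreal (c2 ^ Suc k * K)" if "n k < i" for i k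
    using that
  proof (induction k arbitrary: i)
    case 0
    then obtain m where m: "i = Suc m" by (cases i) auto
    have "?ms (Z (Suc m)) \<le> ennreal (c2 * K)"
      using base s \<zeta>K by (intro step[OF K(1) le0]) (auto simp: t_def grid_def not_le)
    then show ?case using m by simp
  next
    case (Suc k)
    let ?N = "Suc (n k)"
    \<comment> \<open>The predecessor \<open>m\<close> is already at least \<open>n (Suc k)\<close>,
      so both delayed times of the step from \<open>m\<close> to \<open>Suc m\<close> are past
      \<open>t ?N\<close>.\<close>
    obtain m where m: "i = Suc m" "n (Suc k) \<le> m" using Suc.prems by (cases i) auto
    have N: "?N \<le> m" using nxt(1)[of "n k"] m n by simp
    have far: "t ?N \<le> s j" if "j = m \<or> j = Suc m" for j
      using that m n nxt(2)[of "n k" j] by auto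
    have "?ms (Z (Suc m)) \<le> ennreal (c2 * (c2 ^ Suc k * K))"
    proof (rule step[OF _ N])
      show "0 \<le> c2 ^ Suc k * K" using c2_01 K by simp
      show "?ms (Z j) \<le> ennreal (c2 ^ Suc k * K)" if "?N \<le> j" "j \<le> m" for j
        using that by (intro Suc.IH) simp
      \<comment> \<open>Always the second alternative: the delayed time is at least
        \<open>t ?N\<close>, which exceeds \<open>a\<close>, so the initial functions no longer
        enter.\<close>
      show "s j \<le> a \<and> ?ms (\<zeta> (s j)) \<le> ennreal (c2 ^ Suc k * K) \<or> a < s j \<and> t ?N \<le> s j"
        if "j = m \<or> j = Suc m" for j
        using far[OF that] t(1)[of "n k"] t(3)[of "n k"] by linarith
    qed
    then show ?case using m by (simp add: mult_ac)
  qed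
  have "(MAX i\<in>{n k<..n (Suc k)}. ?ms (Z i)) \<le> ennreal (c2 ^ Suc k) * S" for k
  proof -
    have "n k < n (Suc k)" using n_mono by (simp add: strict_mono_Suc_iff)
    \<comment> \<open>\<open>Max\<close> is meaningful only on a nonempty index set, which strict
      monotonicity of \<open>n\<close> supplies.\<close>
    then have ne: "{n k<..n (Suc k)} \<noteq> {}" by auto
    have "ennreal (c2 ^ Suc k) * S = ennreal (c2 ^ Suc k * K)"
      unfolding K(2) using c2_01 K(1) by (intro ennreal_mult[symmetric]) auto
    then show ?thesis using ne decay by (subst Max_le_iff) auto
  qed
  moreover have "(\<lambda>n. ?ms (Z n)) \<longlonglongrightarrow> 0"
  proof (rule order_tendstoI)
    fix e :: ennreal assume e: "0 < e"
    have "(\<lambda>k. c2 ^ Suc k * K) \<longlonglongrightarrow> 0 * K"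
      using c2_01 by (intro tendsto_mult tendsto_const LIMSEQ_Suc LIMSEQ_power_zero) auto
    then have "(\<lambda>k. ennreal (c2 ^ Suc k * K)) \<longlonglongrightarrow> ennreal 0"
      by (intro tendsto_ennrealI) simp
    then have "eventually (\<lambda>k. ennreal (c2 ^ Suc k * K) < e) sequentially"
      using e by (intro order_tendstoD(2)) auto
    \<comment> \<open>A single such \<open>k\<close> controls the whole tail, since
      \<open>decay\<close> covers every index beyond \<open>n k\<close>.\<close>
    then obtain k where "ennreal (c2 ^ Suc k * K) < e" by (auto simp: eventually_sequentially)
    then show "eventually (\<lambda>i. ?ms (Z i) < e) sequentially"
      by (intro eventually_sequentiallyI[of "Suc (n k)"] le_less_trans[OF decay[of k]]) simp_all
  qed simp
  ultimately show ?thesis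
    using c2'(2) c2_01(2) n_mono n(1) filterlim_subseq[OF n_mono]
    unfolding S_def Z_def \<zeta>_def by blast
qed

end
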